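(* For item values that are independently distributed on finite sets, Problem (SP) can be solved in time $\mathcal{O}(m^2n^2 + mn^2A)$.
   Context: Problem (SP), the stochastic bilevel continuous knapsack problem, is: maximize $\mathbb{E}_{\mathbf{c}}(d^\top x^{\mathbf{c}} - \delta b)$ over $b \in [b^-, b^+]$, where for each realization $c$ of the random vector $\mathbf{c}$ the follower's solution $x^{c}$ is an optimal solution of $\max\{c^\top x : a^\top x \le b,\ x \in [0,1]^n\}$. Here $a \in \mathbb{N}^n$ with $a>0$ are item sizes, $d \in \mathbb{Z}^n$ are the leader's item values, $\delta \ge 0$, and $0 \le b^- \le b^+ \le A := \sum_{i=1}^n a_i$. It is assumed that $\mathbb{P}(\mathbf{c}_i/a_i = \mathbf{c}_j/a_j) = 0$ for $i \ne j$ and $\mathbb{P}(\mathbf{c}_i = 0) = 0$. The components $\mathbf{c}_i$ are independent; component $i$ takes $m_i \in \mathbb{N}$ values $c_i^1,\dots,c_i^{m_i}$ with given probabilities $p_i^1,\dots,p_i^{m_i}$, and $m := \max\{m_1,\dots,m_n\}$. *)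

theory Defs
  imports "HOL-Probability.Probability" "HOL-Probability.Product_PMF"
begin

section \<open>The stochastic bilevel continuous knapsack problem\<close>

text \<open>
  Items are numbered from 0. Entry \<open>i\<close> of \<open>laws\<close> lists the pairs (value, probability) of the
  follower's value of item \<open>i\<close>, so its length is the number \<open>m\<^sub>i\<close> of values.
\<close>

record sp_instance =
  sizes :: "nat list"
  leader_values :: "int list"
  laws :: "(real \<times> real) list list"
  delta :: real
  b_min :: real
  b_max :: real

definition num_items :: "sp_instance \<Rightarrow> nat" where
  "num_items I = length (sizes I)"

definition total_size :: "sp_instance \<Rightarrow> nat" where
  "total_size I = (\<Sum>i<num_items I. sizes I ! i)"

definition max_values :: "sp_instance \<Rightarrow> nat" where
  "max_values I = Max ((\<lambda>i. length (laws I ! i)) ` {..<num_items I})"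

definition value_law :: "sp_instance \<Rightarrow> (nat \<Rightarrow> real) pmf" where
  "value_law I = Pi_pmf {..<num_items I} 0 (\<lambda>i. pmf_of_list (laws I ! i))"

definition valid_instance :: "sp_instance \<Rightarrow> bool" where
  "valid_instance I \<longleftrightarrow>
     num_items I \<ge> 1 \<and>
     length (leader_values I) = num_items I \<and>
     length (laws I) = num_items I \<and>
     (\<forall>i<num_items I. sizes I ! i > 0) \<and>
     (\<forall>i<num_items I. pmf_of_list_wf (laws I ! i)) \<and>
     delta I \<ge> 0 \<and>
     0 \<le> b_min I \<and> b_min I \<le> b_max I \<and> b_max I \<le> real (total_size I) \<and>
     (\<forall>i<num_items I. \<forall>j<num_items I. i \<noteq> j \<longrightarrow>
        measure_pmf.prob (value_law I)
          {c. c i / real (sizes I ! i) = c j / real (sizes I ! j)} = 0) \<and>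
     (\<forall>i<num_items I. measure_pmf.prob (value_law I) {c. c i = 0} = 0)"

definition follower_feasible :: "sp_instance \<Rightarrow> real \<Rightarrow> (nat \<Rightarrow> real) \<Rightarrow> bool" where
  "follower_feasible I b x \<longleftrightarrow>
     (\<forall>i<num_items I. x i \<in> {0..1}) \<and> (\<Sum>i<num_items I. real (sizes I ! i) * x i) \<le> b"

definition follower_optimal ::
  "sp_instance \<Rightarrow> real \<Rightarrow> (nat \<Rightarrow> real) \<Rightarrow> (nat \<Rightarrow> real) \<Rightarrow> bool" where
  "follower_optimal I b c x \<longleftrightarrow>
     is_arg_max (\<lambda>x. \<Sum>i<num_items I. c i * x i) (follower_feasible I b) x"

text \<open>
  \<open>X b c\<close> is the follower's solution for capacity \<open>b\<close> and realization \<open>c\<close>.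
\<close>

definition follower_response ::
  "sp_instance \<Rightarrow> (real \<Rightarrow> (nat \<Rightarrow> real) \<Rightarrow> nat \<Rightarrow> real) \<Rightarrow> bool" where
  "follower_response I X \<longleftrightarrow>
     (\<forall>b\<in>{b_min I..b_max I}. \<forall>c\<in>set_pmf (value_law I). follower_optimal I b c (X b c))"

definition leader_objective ::
  "sp_instance \<Rightarrow> (real \<Rightarrow> (nat \<Rightarrow> real) \<Rightarrow> nat \<Rightarrow> real) \<Rightarrow> real \<Rightarrow> real" where
  "leader_objective I X b =
     measure_pmf.expectation (value_law I)
       (\<lambda>c. (\<Sum>i<num_items I. real_of_int (leader_values I ! i) * X b c i) - delta I * b)"

text \<open>
  For valid instances the follower's optimal solution is almost surely unique, so the quantifier
  over \<open>X\<close> expresses only that the choice of an optimal solution is immaterial. A response exists,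
  see \<open>follower_response_exists\<close> below.
\<close>

definition sp_solution :: "sp_instance \<Rightarrow> real \<Rightarrow> real \<Rightarrow> bool" where
  "sp_solution I b v \<longleftrightarrow>
     (\<forall>X. follower_response I X \<longrightarrow>
        is_arg_max (leader_objective I X) (\<lambda>b. b \<in> {b_min I..b_max I}) b \<and>
        v = leader_objective I X b)"

lemma follower_optimal_exists:
  assumes "b \<ge> 0"
  shows "\<exists>x. follower_optimal I b c x"
proof -
  let ?n = "num_items I"
  let ?B = "PiE UNIV (\<lambda>i. if i < ?n then {0..1::real} else {0}) :: (nat \<Rightarrow> real) set"
  let ?w = "\<lambda>x::nat \<Rightarrow> real. \<Sum>i<?n. real (sizes I ! i) * x i"
  let ?f = "\<lambda>x::nat \<Rightarrow> real. \<Sum>i<?n. c i * x i"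
  let ?K = "?B \<inter> {x. ?w x \<le> b}"
  have "compactin (product_topology (\<lambda>i. euclidean) UNIV) ?B"
    by (subst compactin_PiE) auto
  then have "compact ?B"
    by (simp add: euclidean_product_topology)
  moreover have "closed {x. ?w x \<le> b}"
    by (intro closed_Collect_le continuous_intros continuous_on_product_coordinates)
  ultimately have comp: "compact ?K"
    by (rule compact_Int_closed)
  have "(\<lambda>i. 0) \<in> ?K"
    using assms by auto
  then have ne: "?K \<noteq> {}"
    by blast
  have cont: "continuous_on ?K ?f"
    by (intro continuous_intros continuous_on_subset[OF continuous_on_product_coordinates]) auto
  obtain x where x: "x \<in> ?K" "\<And>y. y \<in> ?K \<Longrightarrow> ?f y \<le> ?f x"
    using continuous_attains_sup[OF comp ne cont] by blast
  have "?f y \<le> ?f x" if y: "follower_feasible I b y" for y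
  proof -
    let ?z = "\<lambda>i. if i < ?n then y i else 0"
    have "?w ?z = ?w y" "?f ?z = ?f y"
      by (auto intro!: sum.cong)
    moreover from this y have "?z \<in> ?K"
      by (auto simp: follower_feasible_def)
    ultimately show ?thesis
      using x(2)[of ?z] by simp
  qed
  moreover have "follower_feasible I b x"
    using x(1) by (auto simp: follower_feasible_def PiE_iff split: if_splits)
  ultimately show ?thesis
    unfolding follower_optimal_def is_arg_max_linorder by blast
qed

lemma follower_response_exists:
  assumes "valid_instance I"
  shows "\<exists>X. follower_response I X"
proof -
  have "\<forall>b c. \<exists>x. b \<ge> 0 \<longrightarrow> follower_optimal I b c x"
    using follower_optimal_exists by blast
  then obtain X where "\<forall>b c. b \<ge> 0 \<longrightarrow> follower_optimal I b c (X b c)"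
    by metis
  then have "follower_response I X"
    using assms by (auto simp: follower_response_def valid_instance_def)
  then show ?thesis by blast
qed


section \<open>The machine model\<close>

text \<open>
  A unit-cost real RAM with structured programs. The memory consists of arrays of natural numbers
  and of arrays of real numbers; a fixed program names only finitely many of them, and scalars are
  the entries at index 0. Arrays are addressed by natural numbers. Natural numbers can only be
  added, subtracted (truncated at 0) and compared, real numbers can be added, subtracted,
  multiplied, divided and compared. A natural number can be converted to a real, but there is no
  rounding operation in the other direction, and programs contain no real constants except those
  obtained from natural numbers.
\<close>

record ram_state =
  nat_mem :: "string \<Rightarrow> nat \<Rightarrow> nat"
  real_mem :: "string \<Rightarrow> nat \<Rightarrow> real"

datatype nexp =
    NConst nat
  | NRead string nexp
  | NAdd nexp nexp
  | NSub nexp nexp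

datatype rexp =
    ROfNat nexp
  | RRead string nexp
  | RAdd rexp rexp
  | RSub rexp rexp
  | RMul rexp rexp
  | RDiv rexp rexp

datatype bexp =
    NLess nexp nexp
  | RLess rexp rexp
  | BNot bexp
  | BAnd bexp bexp

datatype com =
    Skip
  | NWrite string nexp nexp
  | RWrite string nexp rexp
  | Seq com com
  | Cond bexp com com
  | While bexp com

fun nval :: "nexp \<Rightarrow> ram_state \<Rightarrow> nat" where
  "nval (NConst k) s = k"
| "nval (NRead x e) s = nat_mem s x (nval e s)"
| "nval (NAdd e f) s = nval e s + nval f s"
| "nval (NSub e f) s = nval e s - nval f s"

fun rval :: "rexp \<Rightarrow> ram_state \<Rightarrow> real" where
  "rval (ROfNat e) s = real (nval e s)"
| "rval (RRead x e) s = real_mem s x (nval e s)"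
| "rval (RAdd e f) s = rval e s + rval f s"
| "rval (RSub e f) s = rval e s - rval f s"
| "rval (RMul e f) s = rval e s * rval f s"
| "rval (RDiv e f) s = rval e s / rval f s"

fun bval :: "bexp \<Rightarrow> ram_state \<Rightarrow> bool" where
  "bval (NLess e f) s \<longleftrightarrow> nval e s < nval f s"
| "bval (RLess e f) s \<longleftrightarrow> rval e s < rval f s"
| "bval (BNot e) s \<longleftrightarrow> \<not> bval e s"
| "bval (BAnd e f) s \<longleftrightarrow> bval e s \<and> bval f s"

fun ncost :: "nexp \<Rightarrow> nat" where
  "ncost (NConst k) = 1"
| "ncost (NRead x e) = 1 + ncost e"
| "ncost (NAdd e f) = 1 + ncost e + ncost f"
| "ncost (NSub e f) = 1 + ncost e + ncost f"

fun rcost :: "rexp \<Rightarrow> nat" where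
  "rcost (ROfNat e) = 1 + ncost e"
| "rcost (RRead x e) = 1 + ncost e"
| "rcost (RAdd e f) = 1 + rcost e + rcost f"
| "rcost (RSub e f) = 1 + rcost e + rcost f"
| "rcost (RMul e f) = 1 + rcost e + rcost f"
| "rcost (RDiv e f) = 1 + rcost e + rcost f"

fun bcost :: "bexp \<Rightarrow> nat" where
  "bcost (NLess e f) = 1 + ncost e + ncost f"
| "bcost (RLess e f) = 1 + rcost e + rcost f"
| "bcost (BNot e) = 1 + bcost e"
| "bcost (BAnd e f) = 1 + bcost e + bcost f"

definition nat_write :: "string \<Rightarrow> nat \<Rightarrow> nat \<Rightarrow> ram_state \<Rightarrow> ram_state" where
  "nat_write x k v s = s\<lparr>nat_mem := (nat_mem s)(x := (nat_mem s x)(k := v))\<rparr>"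

definition real_write :: "string \<Rightarrow> nat \<Rightarrow> real \<Rightarrow> ram_state \<Rightarrow> ram_state" where
  "real_write x k v s = s\<lparr>real_mem := (real_mem s)(x := (real_mem s x)(k := v))\<rparr>"

text \<open>\<open>exec p s t s'\<close>: started in \<open>s\<close>, program \<open>p\<close> halts in \<open>s'\<close> after exactly \<open>t\<close> time units.\<close>

inductive exec :: "com \<Rightarrow> ram_state \<Rightarrow> nat \<Rightarrow> ram_state \<Rightarrow> bool" where
  Skip: "exec Skip s 1 s"
| NWrite: "exec (NWrite x k e) s (1 + ncost k + ncost e) (nat_write x (nval k s) (nval e s) s)"
| RWrite: "exec (RWrite x k e) s (1 + ncost k + rcost e) (real_write x (nval k s) (rval e s) s)"
| Seq: "exec p s t s' \<Longrightarrow> exec q s' u s'' \<Longrightarrow> exec (Seq p q) s (t + u) s''"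
| CondTrue: "bval g s \<Longrightarrow> exec p s t s' \<Longrightarrow> exec (Cond g p q) s (1 + bcost g + t) s'"
| CondFalse: "\<not> bval g s \<Longrightarrow> exec q s t s' \<Longrightarrow> exec (Cond g p q) s (1 + bcost g + t) s'"
| WhileFalse: "\<not> bval g s \<Longrightarrow> exec (While g p) s (1 + bcost g) s"
| WhileTrue: "bval g s \<Longrightarrow> exec p s t s' \<Longrightarrow> exec (While g p) s' u s'' \<Longrightarrow>
    exec (While g p) s (1 + bcost g + t + u) s''"

text \<open>Memory cells that hold no input are 0.\<close>

definition list_mem :: "'a::zero list \<Rightarrow> nat \<Rightarrow> 'a" where
  "list_mem xs k = (if k < length xs then xs ! k else 0)"

definition encode :: "sp_instance \<Rightarrow> ram_state" where
  "encode I = \<lparr>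
     nat_mem = (\<lambda>_ _. 0)
       (''n'' := list_mem [num_items I],
        ''a'' := list_mem (sizes I),
        ''m'' := list_mem (map length (laws I))),
     real_mem = (\<lambda>_ _. 0)
       (''d'' := list_mem (map real_of_int (leader_values I)),
        ''c'' := list_mem (map fst (concat (laws I))),
        ''p'' := list_mem (map snd (concat (laws I))),
        ''delta'' := list_mem [delta I],
        ''b_min'' := list_mem [b_min I],
        ''b_max'' := list_mem [b_max I])\<rparr>"

text \<open>
  Solving the problem means writing an optimal capacity to \<open>b\<close> and the optimal value to \<open>value\<close>.
  The time bound \<open>T\<close> is up to a constant factor independent of the instance.
\<close>

definition solves_SP_in_time_O :: "com \<Rightarrow> (sp_instance \<Rightarrow> nat) \<Rightarrow> bool" where
  "solves_SP_in_time_O prog T \<longleftrightarrow>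
     (\<exists>C::nat. \<forall>I. valid_instance I \<longrightarrow>
        (\<exists>t s. exec prog (encode I) t s \<and> t \<le> C * T I \<and>
               sp_solution I (real_mem s ''b'' 0) (real_mem s ''value'' 0)))"

end

theory Submission
  imports Defs
begin

text \<open>
  Almost surely the follower fills the knapsack greedily, so if \<open>S\<close> is the total size of the items
  with a better ratio than item \<open>i\<close> and \<open>i\<close> has positive value, then \<open>i\<close> receives the capacity
  \<open>max 0 (b - S) - max 0 (b - S - a\<^sub>i)\<close>. Given the value of item \<open>i\<close>, the load \<open>S\<close> is a sum of
  independent two-point variables: their probabilities are found in time \<open>O(m n)\<close> and the
  distribution of \<open>S\<close> by convolution in time \<open>O(n A)\<close>. Over all items and values this costs
  \<open>O(m\<^sup>2n\<^sup>2 + m n\<^sup>2 A)\<close>, and it yields the leader's objective as a combination of the ramps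
  \<open>max 0 (b - s)\<close> with integer \<open>s\<close>. This function is affine between consecutive integers, so it
  is maximized by one scan over the integers clamped to the interval of capacities.
\<close>

section \<open>Expectations under finite product distributions\<close>

text \<open>The follower's packing order depends on all values at once. Fixing the value of one item
  \<open>i\<close> removes this obstacle: every other item then lies in front of \<open>i\<close> or
  behind it, independently of the rest, and only the total size of those in front matters.
  Subtracting the ramp that starts \<open>a\<^sub>i\<close> later amounts to shifting the
  distribution of the load by \<open>a\<^sub>i\<close>, so the expected objective is stored as one
  coefficient per integer, the jump of its slope. Ramps starting at \<open>A\<close> or later vanish
  on the interval of capacities, hence \<open>A + 1\<close> cells suffice. The greedy rule is
  obtained from local optimality conditions for one item at a time, without sorting. The end points
  of the interval are real and the machine cannot round, so the scan visits all integers from 0 to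
  \<open>A\<close> and clamps each. Time is tracked by triples with a frame rule in which loop costs
  multiply; lower-order terms are absorbed because \<open>n\<close>, \<open>m\<close> and
  \<open>A\<close> are at least 1.\<close>

lemma expectation_pmf_of_list:
  fixes h :: "'a \<Rightarrow> real"
  assumes "pmf_of_list_wf xs"
  shows "measure_pmf.expectation (pmf_of_list xs) h = (\<Sum>l<length xs. snd (xs ! l) * h (fst (xs ! l)))"
proof -
  have "sum_list (map snd (filter (\<lambda>z. fst z = x) xs)) =
      (\<Sum>l<length xs. if fst (xs ! l) = x then snd (xs ! l) else 0)" for x
    by (subst sum_list_map_filter') (simp add: sum_list_sum_nth atLeast0LessThan)
  then have "measure_pmf.expectation (pmf_of_list xs) h =
      (\<Sum>x\<in>set (map fst xs). \<Sum>l<length xs. if fst (xs ! l) = x then snd (xs ! l) * h x else 0)"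
    using set_pmf_of_list[OF assms]
    by (subst integral_measure_pmf_real[of "set (map fst xs)"])
      (auto simp: pmf_pmf_of_list[OF assms] sum_distrib_left mult.commute intro!: sum.cong)
  also have "\<dots> = (\<Sum>l<length xs. \<Sum>x\<in>set (map fst xs). if fst (xs ! l) = x then snd (xs ! l) * h x else 0)"
    by (rule sum.swap)
  finally show ?thesis
    by (simp add: sum.delta)
qed

lemma finite_set_Pi_pmf:
  assumes "finite J" "\<And>j. j \<in> J \<Longrightarrow> finite (set_pmf (p j))"
  shows "finite (set_pmf (Pi_pmf J dflt p))"
  using assms
proof (induction J)
  case (insert j J)
  then show ?case
    by (subst Pi_pmf_insert) auto
qed simp

text \<open>Fubini for one coordinate: the product is drawn by choosing \<open>v\<close> for
  \<open>j\<close> and then the others independently. Finite supports turn the outer integral into a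
  finite sum.\<close>

lemma expectation_Pi_pmf_insert:
  fixes h :: "('a \<Rightarrow> 'b) \<Rightarrow> real"
  assumes J: "finite J" "j \<notin> J" and fin: "\<And>i. i \<in> insert j J \<Longrightarrow> finite (set_pmf (p i))"
  shows "measure_pmf.expectation (Pi_pmf (insert j J) dflt p) h =
    measure_pmf.expectation (p j)
      (\<lambda>v. measure_pmf.expectation (Pi_pmf J dflt p) (\<lambda>c. h (c(j := v))))"
proof -
  have "Pi_pmf (insert j J) dflt p = p j \<bind> (\<lambda>v. map_pmf (\<lambda>c. c(j := v)) (Pi_pmf J dflt p))"
    using J by (simp add: Pi_pmf_insert' map_pmf_def)
  then have "measure_pmf.expectation (Pi_pmf (insert j J) dflt p) h =
      (\<Sum>v\<in>set_pmf (p j). pmf (p j) v *\<^sub>R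
        measure_pmf.expectation (map_pmf (\<lambda>c. c(j := v)) (Pi_pmf J dflt p)) h)"
    using J fin by (simp add: pmf_expectation_bind[of "set_pmf (p j)"] finite_set_Pi_pmf)
  then show ?thesis
    using fin by (subst integral_measure_pmf[of "set_pmf (p j)"]) auto
qed

text \<open>Convolution with the point mass at \<open>a\<close>. The case distinction is essential,
  since truncated subtraction would otherwise yield \<open>f 0\<close> for all
  \<open>s < a\<close>.\<close>

definition shifted :: "nat \<Rightarrow> (nat \<Rightarrow> real) \<Rightarrow> nat \<Rightarrow> real" where
  "shifted a f s = (if s < a then 0 else f (s - a))"

lemma sum_shifted:
  fixes g :: "nat \<Rightarrow> real"
  shows "(\<Sum>s\<le>B + a. shifted a f s * g s) = (\<Sum>s\<le>B. f s * g (s + a))"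
proof -
  have "(\<Sum>s\<le>B + a. shifted a f s * g s) = (\<Sum>s\<in>{a..B + a}. shifted a f s * g s)"
    by (rule sum.mono_neutral_right) (auto simp: shifted_def)
  also have "\<dots> = (\<Sum>s\<in>{0..B}. shifted a f (s + a) * g (s + a))"
    using sum.shift_bounds_cl_nat_ivl[of "\<lambda>s. shifted a f s * g s" 0 a B] by simp
  finally show ?thesis
    by (simp add: shifted_def atMost_atLeast0)
qed

section \<open>The load of better items\<close>

text \<open>Ratios are compared after cross-multiplication with the sizes. The clause
  \<open>j \<noteq> i\<close> gives item \<open>i\<close> probability 0, so that its step in
  \<open>load_dist\<close> changes nothing and the loop over all items needs no exception.\<close>

definition better_prob :: "sp_instance \<Rightarrow> nat \<Rightarrow> real \<Rightarrow> nat \<Rightarrow> real" where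
  "better_prob I i v j = (\<Sum>l<length (laws I ! j).
     if v * real (sizes I ! j) < fst (laws I ! j ! l) * real (sizes I ! i) \<and> j \<noteq> i
     then snd (laws I ! j ! l) else 0)"

text \<open>
  For \<open>j = num_items I\<close> the result is the distribution of the load in front of item \<open>i\<close>, given
  that item \<open>i\<close> has value \<open>v\<close>.
\<close>

primrec load_dist :: "sp_instance \<Rightarrow> nat \<Rightarrow> real \<Rightarrow> nat \<Rightarrow> nat \<Rightarrow> real" where
  "load_dist I i v 0 = (\<lambda>s. if s = 0 then 1 else 0)"
| "load_dist I i v (Suc j) = (\<lambda>s. load_dist I i v j s * (1 - better_prob I i v j) +
     shifted (sizes I ! j) (load_dist I i v j) s * better_prob I i v j)"

definition load :: "sp_instance \<Rightarrow> nat \<Rightarrow> real \<Rightarrow> nat set \<Rightarrow> (nat \<Rightarrow> real) \<Rightarrow> nat" where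
  "load I i v J c = (\<Sum>j\<in>J. if v * real (sizes I ! j) < c j * real (sizes I ! i) then sizes I ! j else 0)"

text \<open>Induction on the number of items, conditioning on the value of item \<open>k\<close>: it
  either adds its size to the load or adds nothing. Both \<open>h\<close> and \<open>B\<close> must
  vary, because the first case uses the test function shifted by the size together with a smaller
  bound.\<close>

lemma expectation_load:
  assumes wf: "\<And>j. j < k \<Longrightarrow> pmf_of_list_wf (laws I ! j)"
    and "(\<Sum>j<k. sizes I ! j) \<le> B"
  shows "measure_pmf.expectation (Pi_pmf ({..<k} - {i}) 0 (\<lambda>j. pmf_of_list (laws I ! j)))
      (\<lambda>c. h (load I i v ({..<k} - {i}) c)) = (\<Sum>s\<le>B. load_dist I i v k s * h s)"
  using assms
proof (induction k arbitrary: h B)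
  case 0
  then show ?case
    by (simp add: load_def if_distrib[of "\<lambda>x. x * _"] cong: if_cong)
next
  case (Suc k)
  let ?J = "{..<k} - {i}" and ?Q = "better_prob I i v k" and ?a = "sizes I ! k"
  let ?P = "\<lambda>J. Pi_pmf J 0 (\<lambda>j. pmf_of_list (laws I ! j))"
  have wf: "pmf_of_list_wf (laws I ! j)" if "j < Suc k" for j
    using Suc.prems(1) that by blast
  have IH: "measure_pmf.expectation (?P ?J) (\<lambda>c. h (load I i v ?J c)) =
      (\<Sum>s\<le>B. load_dist I i v k s * h s)"
    if "(\<Sum>j<k. sizes I ! j) \<le> B" for h B
    using Suc.IH[OF _ that] wf by simp
  show ?case
  proof (cases "k = i")
    case True
    then have "{..<Suc k} - {i} = ?J" "?Q = 0"
      by (auto simp: better_prob_def)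
    then show ?thesis
      using IH[of B h] Suc.prems(2) by simp
  next
    case False
    then have eq: "{..<Suc k} - {i} = insert k ?J"
      by auto
    have load: "load I i v (insert k ?J) (c(k := w)) =
        load I i v ?J c + (if v * real ?a < w * real (sizes I ! i) then ?a else 0)" for c w
      by (simp add: load_def)
    let ?E = "\<lambda>h. measure_pmf.expectation (?P ?J) (\<lambda>c. h (load I i v ?J c))"
    have one: "(\<Sum>l<length (laws I ! k). snd (laws I ! k ! l)) = 1"
      using wf[of k] by (simp add: pmf_of_list_wf_def sum_list_sum_nth atLeast0LessThan)
    have "measure_pmf.expectation (?P ({..<Suc k} - {i})) (\<lambda>c. h (load I i v ({..<Suc k} - {i}) c)) =
        measure_pmf.expectation (pmf_of_list (laws I ! k))
          (\<lambda>w. if v * real ?a < w * real (sizes I ! i) then ?E (\<lambda>s. h (s + ?a)) else ?E h)"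
      unfolding eq using wf
      by (subst expectation_Pi_pmf_insert)
        (auto simp: finite_set_pmf_of_list load intro!: Bochner_Integration.integral_cong)
    also have "\<dots> = (\<Sum>l<length (laws I ! k). snd (laws I ! k ! l) *
        (if v * real ?a < fst (laws I ! k ! l) * real (sizes I ! i)
         then ?E (\<lambda>s. h (s + ?a)) else ?E h))"
      using wf by (simp add: expectation_pmf_of_list)
    \<comment> \<open>A case distinction between \<open>x\<close> and \<open>y\<close> is written as
      \<open>y\<close> plus an indicator times \<open>x - y\<close>; then the total probability 1
      and \<open>better_prob\<close> factor out.\<close>
    also have "\<dots> = (\<Sum>l<length (laws I ! k). snd (laws I ! k ! l) * ?E h +
        (if v * real ?a < fst (laws I ! k ! l) * real (sizes I ! i) \<and> k \<noteq> i
         then snd (laws I ! k ! l) else 0) * (?E (\<lambda>s. h (s + ?a)) - ?E h))"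
      using False by (intro sum.cong) (auto simp: algebra_simps)
    also have "\<dots> = ?E h + ?Q * (?E (\<lambda>s. h (s + ?a)) - ?E h)"
      by (simp add: sum.distrib one better_prob_def flip: sum_distrib_right)
    also have "?E h = (\<Sum>s\<le>B. load_dist I i v k s * h s)"
      using Suc.prems by (intro IH) auto
    \<comment> \<open>The first \<open>k\<close> items fit below \<open>B - ?a\<close>, and with
      this bound \<open>sum_shifted\<close> leads back to a sum up to \<open>B\<close>.\<close>
    also have "?E (\<lambda>s. h (s + ?a)) = (\<Sum>s\<le>B - ?a. load_dist I i v k s * h (s + ?a))"
      using Suc.prems by (intro IH) auto
    also have "\<dots> = (\<Sum>s\<le>B. shifted ?a (load_dist I i v k) s * h s)"
      using Suc.prems(2) by (subst sum_shifted[symmetric]) simp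
    finally show ?thesis
      by (simp add: algebra_simps sum.distrib sum_subtractf sum_distrib_left)
  qed
qed

text \<open>Conditioning on the value of item \<open>i\<close> works because the load in front of
  \<open>i\<close> reads only the other coordinates once that value is fixed.\<close>

lemma expectation_value_law:
  assumes I: "valid_instance I" and i: "i < num_items I"
  shows "measure_pmf.expectation (value_law I)
      (\<lambda>c. g (c i) (load I i (c i) ({..<num_items I} - {i}) c)) =
    (\<Sum>k<length (laws I ! i). snd (laws I ! i ! k) *
      (\<Sum>s\<le>total_size I. load_dist I i (fst (laws I ! i ! k)) (num_items I) s *
        g (fst (laws I ! i ! k)) s))"
proof -
  let ?J = "{..<num_items I} - {i}"
  let ?p = "\<lambda>j. pmf_of_list (laws I ! j)"
  have wf: "pmf_of_list_wf (laws I ! j)" if "j < num_items I" for j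
    using I that by (simp add: valid_instance_def)
  have J: "{..<num_items I} = insert i ?J"
    using i by auto
  have load: "load I i v ?J (c(i := w)) = load I i v ?J c" for v c w
    by (auto simp: load_def intro!: sum.cong)
  have "measure_pmf.expectation (value_law I)
      (\<lambda>c. g (c i) (load I i (c i) ?J c)) = measure_pmf.expectation (?p i)
      (\<lambda>v. measure_pmf.expectation (Pi_pmf ?J 0 ?p) (\<lambda>c. g v (load I i v ?J c)))"
    unfolding value_law_def
    by (subst J, subst expectation_Pi_pmf_insert)
      (use i wf in \<open>auto simp: finite_set_pmf_of_list load\<close>)
  also have "\<dots> = measure_pmf.expectation (?p i)
      (\<lambda>v. \<Sum>s\<le>total_size I. load_dist I i v (num_items I) s * g v s)"
    using wf by (subst expectation_load) (auto simp: total_size_def)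
  finally show ?thesis
    using i wf by (simp add: expectation_pmf_of_list)
qed

section \<open>The follower's optimum\<close>

text \<open>The first-order optimality condition: the objective is linear, so no direction that
  stays feasible for some positive step can increase it. The next three lemmas instantiate the
  direction \<open>y\<close>.\<close>

lemma follower_optimal_perturb:
  assumes opt: "follower_optimal I b c x"
    and box: "\<And>i. i < num_items I \<Longrightarrow> x i + t * y i \<in> {0..1}"
    and cap: "(\<Sum>i<num_items I. real (sizes I ! i) * x i) +
      t * (\<Sum>i<num_items I. real (sizes I ! i) * y i) \<le> b"
    and t: "t > 0"
  shows "(\<Sum>i<num_items I. c i * y i) \<le> 0"
proof -
  have lin: "(\<Sum>i<num_items I. f i * (x i + t * y i)) =
      (\<Sum>i<num_items I. f i * x i) + t * (\<Sum>i<num_items I. f i * y i)" for f :: "nat \<Rightarrow> real"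
    by (simp add: algebra_simps sum.distrib sum_distrib_left)
  have "follower_feasible I b (\<lambda>i. x i + t * y i)"
    using box cap unfolding follower_feasible_def lin by blast
  then have "(\<Sum>i<num_items I. c i * (x i + t * y i)) \<le> (\<Sum>i<num_items I. c i * x i)"
    using opt by (auto simp: follower_optimal_def is_arg_max_linorder)
  then show ?thesis
    using t by (simp add: lin mult_le_0_iff)
qed

text \<open>Otherwise capacity could be moved from \<open>i\<close> to \<open>j\<close>: raising
  \<open>x j\<close> in proportion to the size of \<open>i\<close> and lowering \<open>x i\<close>
  in proportion to the size of \<open>j\<close> keeps the total weight and gains value.\<close>

lemma follower_optimal_exchange:
  assumes opt: "follower_optimal I b c x"
    and ij: "i < num_items I" "j < num_items I" and pos: "sizes I ! i > 0" "sizes I ! j > 0"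
    and better: "c i * real (sizes I ! j) < c j * real (sizes I ! i)"
    and x: "x i > 0"
  shows "x j = 1"
proof (rule ccontr)
  assume "x j \<noteq> 1"
  have feas: "follower_feasible I b x"
    using opt by (simp add: follower_optimal_def is_arg_max_linorder)
  then have box: "x k \<in> {0..1}" if "k < num_items I" for k
    using that by (simp add: follower_feasible_def)
  have ne: "i \<noteq> j" using better by auto
  let ?ai = "real (sizes I ! i)" and ?aj = "real (sizes I ! j)"
  let ?y = "\<lambda>k. (if k = j then ?ai else 0) + (if k = i then - ?aj else 0)"
  have sum_y: "(\<Sum>k<num_items I. f k * ?y k) = f j * ?ai - f i * ?aj" for f :: "nat \<Rightarrow> real"
  proof -
    have "(\<Sum>k<num_items I. f k * ?y k) = (\<Sum>k<num_items I.
        (if k = j then f k * ?ai else 0) + (if k = i then - (f k * ?aj) else 0))"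
      by (intro sum.cong) auto
    then show ?thesis
      using ij by (simp add: sum.distrib)
  qed
  \<comment> \<open>The largest step for which \<open>x i\<close> stays nonnegative and
    \<open>x j\<close> stays at most 1.\<close>
  define t where "t = min (x i / ?aj) ((1 - x j) / ?ai)"
  have t: "t > 0" "t * ?aj \<le> x i" "t * ?ai \<le> 1 - x j"
    using x pos box[of j] ij \<open>x j \<noteq> 1\<close> by (auto simp: t_def min_def field_simps)
  have "0 \<le> t * ?ai" "0 \<le> t * ?aj" using t(1) by auto
  then have "x i - t * ?aj \<le> 1" "0 \<le> x j + t * ?ai"
    using box[OF ij(1)] box[OF ij(2)] by auto
  then have "x k + t * ?y k \<in> {0..1}" if "k < num_items I" for k
    using t box[OF that] box[OF ij(1)] box[OF ij(2)] ne by auto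
  moreover have "(\<Sum>k<num_items I. real (sizes I ! k) * x k) +
      t * (\<Sum>k<num_items I. real (sizes I ! k) * ?y k) \<le> b"
    using feas unfolding sum_y by (simp add: follower_feasible_def)
  ultimately have "(\<Sum>k<num_items I. c k * ?y k) \<le> 0"
    using t(1) by (intro follower_optimal_perturb[OF opt, of t]) auto
  then show False
    using better unfolding sum_y by simp
qed

lemma follower_optimal_nonprofitable:
  assumes opt: "follower_optimal I b c x" and i: "i < num_items I" and neg: "c i < 0"
  shows "x i = 0"
proof (rule ccontr)
  assume "x i \<noteq> 0"
  have feas: "follower_feasible I b x"
    using opt by (simp add: follower_optimal_def is_arg_max_linorder)
  then have box: "x k \<in> {0..1}" if "k < num_items I" for k
    using that by (simp add: follower_feasible_def)
  then have xi: "x i > 0" using i \<open>x i \<noteq> 0\<close> by (simp add: less_le)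
  let ?y = "\<lambda>k. if k = i then - 1 else 0 :: real"
  have sum_y: "(\<Sum>k<num_items I. f k * ?y k) = - f i" for f :: "nat \<Rightarrow> real"
    using i by (simp add: if_distrib cong: if_cong)
  have "(\<Sum>k<num_items I. c k * ?y k) \<le> 0"
  proof (rule follower_optimal_perturb[OF opt _ _ xi])
    show "x k + x i * ?y k \<in> {0..1}" if "k < num_items I" for k
      using box[OF that] by auto
    show "(\<Sum>k<num_items I. real (sizes I ! k) * x k) +
        x i * (\<Sum>k<num_items I. real (sizes I ! k) * ?y k) \<le> b"
      using feas xi unfolding sum_y follower_feasible_def
      by (smt (verit) mult_nonneg_nonneg of_nat_0_le_iff mult_minus_right)
  qed
  then show False
    using neg unfolding sum_y by simp
qed

text \<open>If capacity were left over, more of the profitable item \<open>i\<close> could be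
  packed; the step is limited by the box and by the slack.\<close>

lemma follower_optimal_tight:
  assumes opt: "follower_optimal I b c x" and i: "i < num_items I" and pos: "c i > 0"
    and a: "sizes I ! i > 0" and x: "x i \<noteq> 1"
  shows "(\<Sum>k<num_items I. real (sizes I ! k) * x k) = b"
proof (rule ccontr)
  assume neq: "(\<Sum>k<num_items I. real (sizes I ! k) * x k) \<noteq> b" (is "?w \<noteq> b")
  have feas: "follower_feasible I b x"
    using opt by (simp add: follower_optimal_def is_arg_max_linorder)
  then have box: "x k \<in> {0..1}" if "k < num_items I" for k
    using that by (simp add: follower_feasible_def)
  have slack: "?w < b" using feas neq by (simp add: follower_feasible_def)
  let ?y = "\<lambda>k. if k = i then 1 else 0 :: real"
  have sum_y: "(\<Sum>k<num_items I. f k * ?y k) = f i" for f :: "nat \<Rightarrow> real"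
    using i by (simp add: if_distrib cong: if_cong)
  define t where "t = min (1 - x i) ((b - ?w) / real (sizes I ! i))"
  have t: "t > 0" "t \<le> 1 - x i" "t * real (sizes I ! i) \<le> b - ?w"
    using box[OF i] x a slack by (auto simp: t_def min_def field_simps)
  have "(\<Sum>k<num_items I. c k * ?y k) \<le> 0"
  proof (rule follower_optimal_perturb[OF opt _ _ t(1)])
    show "x k + t * ?y k \<in> {0..1}" if "k < num_items I" for k
      using box[OF that] t by auto
    show "?w + t * (\<Sum>k<num_items I. real (sizes I ! k) * ?y k) \<le> b"
      using t(3) unfolding sum_y by simp
  qed
  then show False
    using pos unfolding sum_y by simp
qed

text \<open>Without ties, the other items split into better ones \<open>G\<close> and worse ones
  \<open>L\<close>. If \<open>x i > 0\<close>, the exchange argument fills all of \<open>G\<close>;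
  if \<open>x i < 1\<close>, it empties \<open>L\<close> and the knapsack is full. Hence
  \<open>x i = 0\<close> forces \<open>b \<le> S\<close>, \<open>x i = 1\<close> forces
  \<open>S + a\<^sub>i \<le> b\<close>, and a fractional \<open>x i\<close> uses exactly the
  capacity beyond \<open>S\<close>. The difference of two ramps expresses all three cases.\<close>

lemma follower_optimal_unique:
  assumes opt: "follower_optimal I b c x" and i: "i < num_items I"
    and pos: "\<And>j. j < num_items I \<Longrightarrow> sizes I ! j > 0"
    and nz: "c i \<noteq> 0"
    and distinct: "\<And>j. j < num_items I \<Longrightarrow> j \<noteq> i \<Longrightarrow>
      c i / real (sizes I ! i) \<noteq> c j / real (sizes I ! j)"
  defines "S \<equiv> real (load I i (c i) ({..<num_items I} - {i}) c)"
  shows "real (sizes I ! i) * x i = (if c i > 0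
    then max 0 (b - S) - max 0 (b - S - real (sizes I ! i)) else 0)"
proof (cases "c i > 0")
  case False
  then show ?thesis
    using follower_optimal_nonprofitable[OF opt i] nz by simp
next
  case True
  let ?n = "num_items I" and ?a = "\<lambda>j. real (sizes I ! j)"
  define G where "G = {j. j < ?n \<and> c i * ?a j < c j * ?a i}"
  define L where "L = {j. j < ?n \<and> c j * ?a i < c i * ?a j}"
  have feas: "follower_feasible I b x"
    using opt by (simp add: follower_optimal_def is_arg_max_linorder)
  then have box: "x k \<in> {0..1}" if "k < ?n" for k
    using that by (simp add: follower_feasible_def)
  have cap: "(\<Sum>k<?n. ?a k * x k) \<le> b"
    using feas by (simp add: follower_feasible_def)
  have split: "{..<?n} = insert i (G \<union> L)"
    using i distinct pos by (fastforce simp: G_def L_def field_simps)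
  have disj: "i \<notin> G \<union> L" "G \<inter> L = {}" "finite G" "finite L"
    by (auto simp: G_def L_def)
  have w: "(\<Sum>k<?n. ?a k * x k) = ?a i * x i + ((\<Sum>k\<in>G. ?a k * x k) + (\<Sum>k\<in>L. ?a k * x k))"
    unfolding split using disj by (simp add: sum.union_disjoint)
  have S: "S = (\<Sum>k\<in>G. ?a k)"
  proof -
    have "load I i (c i) ({..<?n} - {i}) c = (\<Sum>k\<in>{..<?n} - {i}. if k \<in> G then sizes I ! k else 0)"
      unfolding load_def by (intro sum.cong) (auto simp: G_def)
    also have "\<dots> = (\<Sum>k\<in>G. sizes I ! k)"
      by (subst sum.inter_restrict[symmetric]) (auto simp: G_def intro!: sum.cong)
    finally show ?thesis by (simp add: S_def)
  qed
  have better: "x k = 1" if "k \<in> G" "x i > 0" for k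
    using follower_optimal_exchange[OF opt i, of k] that pos i by (auto simp: G_def)
  have worse: "x k = 0" if "k \<in> L" "x i \<noteq> 1" for k
    using follower_optimal_exchange[OF opt _ i, of k] that pos i box[of k] by (force simp: L_def)
  have G1: "(\<Sum>k\<in>G. ?a k * x k) = S" if "x i > 0"
    using better that by (simp add: S)
  have G2: "(\<Sum>k\<in>G. ?a k * x k) \<le> S"
    unfolding S using box by (intro sum_mono mult_left_le) (auto simp: G_def)
  have L1: "(\<Sum>k\<in>L. ?a k * x k) = 0" if "x i \<noteq> 1"
    using worse that by simp
  have L2: "(\<Sum>k\<in>L. ?a k * x k) \<ge> 0"
    using box by (intro sum_nonneg mult_nonneg_nonneg) (auto simp: L_def)
  have tight: "(\<Sum>k<?n. ?a k * x k) = b" if "x i \<noteq> 1"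
    using follower_optimal_tight[OF opt i True] pos i that by simp
  have ai: "?a i > 0" using pos i by simp
  consider "x i = 0" | "x i = 1" | "0 < x i" "x i < 1"
    using box[OF i] by fastforce
  then show ?thesis
  proof cases
    case 1
    then have "b \<le> S" using tight w L1 G2 by simp
    then show ?thesis using 1 ai by simp
  next
    case 2
    then have "S + ?a i \<le> b" using cap w G1 L2 by simp
    then show ?thesis using 2 ai True by simp
  next
    case 3
    then have "b = ?a i * x i + S" using tight w L1 G1 by simp
    moreover have "0 < ?a i * x i" "?a i * x i < ?a i" using 3 ai by auto
    ultimately show ?thesis using True by simp
  qed
qed

section \<open>The leader's objective\<close>

text \<open>The leader's gain per unit of capacity given to item \<open>i\<close>, weighted with the
  probability of value \<open>k\<close>; an item that the follower does not want yields
  nothing.\<close>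

definition weight :: "sp_instance \<Rightarrow> nat \<Rightarrow> nat \<Rightarrow> real" where
  "weight I i k = (if 0 < fst (laws I ! i ! k)
     then snd (laws I ! i ! k) * real_of_int (leader_values I ! i) / real (sizes I ! i) else 0)"

text \<open>
  Contribution of value \<open>k\<close> of item \<open>i\<close> to the jump of the slope of the leader's objective at
  capacity \<open>s\<close>.
\<close>

definition kink_term :: "sp_instance \<Rightarrow> nat \<Rightarrow> nat \<Rightarrow> nat \<Rightarrow> real" where
  "kink_term I i k s = (let P = load_dist I i (fst (laws I ! i ! k)) (num_items I)
     in weight I i k * (P s - shifted (sizes I ! i) P s))"

definition kink :: "sp_instance \<Rightarrow> nat \<Rightarrow> real" where
  "kink I s = (\<Sum>i<num_items I. \<Sum>k<length (laws I ! i). kink_term I i k s)"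

text \<open>The representation of a piecewise linear function by its slope jumps. It is meant for
  \<open>b\<close> up to the total size, where ramps starting later vanish.\<close>

definition ramp_sum :: "sp_instance \<Rightarrow> real \<Rightarrow> real" where
  "ramp_sum I b = (\<Sum>s\<le>total_size I. kink I s * max 0 (b - real s))"

text \<open>Conditionally on the value, the contribution is a difference of two ramps at the load
  and at the load plus the size of \<open>i\<close>. \<open>sum_shifted\<close> moves the shift from
  the ramp to the distribution, which produces \<open>kink_term\<close>.\<close>

lemma expectation_item:
  assumes I: "valid_instance I" and i: "i < num_items I"
    and X: "follower_response I X" and b: "b \<in> {b_min I..b_max I}"
  shows "measure_pmf.expectation (value_law I) (\<lambda>c. real_of_int (leader_values I ! i) * X b c i) =
    (\<Sum>s\<le>total_size I. (\<Sum>k<length (laws I ! i). kink_term I i k s) * max 0 (b - real s))"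
proof -
  let ?A = "total_size I" and ?a = "sizes I ! i" and ?d = "real_of_int (leader_values I ! i)"
  let ?P = "\<lambda>k. load_dist I i (fst (laws I ! i ! k)) (num_items I)"
  define r where "r s = max 0 (b - real s)" for s
  have pos: "sizes I ! j > 0" if "j < num_items I" for j
    using I that by (simp add: valid_instance_def)
  have bA: "b \<le> real ?A"
    using I b by (auto simp: valid_instance_def)
  define g where "g v s = (if v > 0 then ?d / real ?a * (r s - r (s + ?a)) else 0)" for v :: real and s
  have X_eq: "?d * X b c i = g (c i) (load I i (c i) ({..<num_items I} - {i}) c)"
    if c: "c \<in> set_pmf (value_law I)" for c
  proof -
    have opt: "follower_optimal I b c (X b c)"
      using X b c by (simp add: follower_response_def)
    have nz: "c i \<noteq> 0"
      using I i c by (auto simp: valid_instance_def measure_pmf_zero_iff)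
    have dist: "c i / real ?a \<noteq> c j / real (sizes I ! j)" if "j < num_items I" "j \<noteq> i" for j
    proof -
      have "set_pmf (value_law I) \<inter> {c. c i / real ?a = c j / real (sizes I ! j)} = {}"
        using I i that by (simp add: valid_instance_def measure_pmf_zero_iff)
      then show ?thesis using c by blast
    qed
    have "real ?a * X b c i = (if c i > 0
      then max 0 (b - real (load I i (c i) ({..<num_items I} - {i}) c)) -
        max 0 (b - real (load I i (c i) ({..<num_items I} - {i}) c) - real ?a) else 0)"
      using follower_optimal_unique[OF opt i pos nz dist] by simp
    then have "?d / real ?a * (real ?a * X b c i) = g (c i) (load I i (c i) ({..<num_items I} - {i}) c)"
      unfolding g_def r_def by (simp add: diff_diff_eq)
    then show ?thesis using pos[OF i] by simp
  qed
  have summand: "snd (laws I ! i ! k) * (\<Sum>s\<le>?A. ?P k s * g (fst (laws I ! i ! k)) s) =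
      (\<Sum>s\<le>?A. kink_term I i k s * r s)" for k
  proof -
    have "(\<Sum>s\<le>?A. ?P k s * r (s + ?a)) = (\<Sum>s\<le>?A + ?a. shifted ?a (?P k) s * r s)"
      by (rule sum_shifted[symmetric])
    \<comment> \<open>The range can be cut at \<open>?A\<close> because \<open>r s = 0\<close> for
      \<open>s \<ge> b\<close> and \<open>b \<le> ?A\<close>.\<close>
    also have "\<dots> = (\<Sum>s\<le>?A. shifted ?a (?P k) s * r s)"
      using bA by (intro sum.mono_neutral_right) (auto simp: r_def)
    finally have shift: "(\<Sum>s\<le>?A. ?P k s * r (s + ?a)) = (\<Sum>s\<le>?A. shifted ?a (?P k) s * r s)" .
    have "snd (laws I ! i ! k) * (\<Sum>s\<le>?A. ?P k s * g (fst (laws I ! i ! k)) s) =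
        weight I i k * ((\<Sum>s\<le>?A. ?P k s * r s) - (\<Sum>s\<le>?A. ?P k s * r (s + ?a)))"
      by (simp add: g_def weight_def sum_distrib_left sum_subtractf algebra_simps diff_divide_distrib)
    also have "\<dots> = (\<Sum>s\<le>?A. kink_term I i k s * r s)"
      unfolding shift by (simp add: kink_term_def Let_def sum_distrib_left sum_subtractf algebra_simps)
    finally show ?thesis .
  qed
  \<comment> \<open>The formula for \<open>X b c i\<close> is available only on the support, where
    ties and zero values do not occur.\<close>
  have "measure_pmf.expectation (value_law I) (\<lambda>c. ?d * X b c i) =
      measure_pmf.expectation (value_law I)
        (\<lambda>c. g (c i) (load I i (c i) ({..<num_items I} - {i}) c))"
    using X_eq by (intro integral_cong_AE) (auto simp: AE_measure_pmf_iff)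
  also have "\<dots> = (\<Sum>k<length (laws I ! i). \<Sum>s\<le>?A. kink_term I i k s * r s)"
    unfolding expectation_value_law[OF I i] summand ..
  also have "\<dots> = (\<Sum>s\<le>?A. \<Sum>k<length (laws I ! i). kink_term I i k s * r s)"
    by (rule sum.swap)
  finally show ?thesis
    by (simp add: r_def sum_distrib_right)
qed

text \<open>Linearity of expectation over the items. The right-hand side does not mention
  \<open>X\<close>, so the maximizers are the same for every follower response.\<close>

lemma leader_objective_eq:
  assumes I: "valid_instance I" and X: "follower_response I X" and b: "b \<in> {b_min I..b_max I}"
  shows "leader_objective I X b = ramp_sum I b - delta I * b"
proof -
  have "finite (set_pmf (value_law I))"
    using I by (auto simp: value_law_def valid_instance_def finite_set_pmf_of_list
      intro!: finite_set_Pi_pmf)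
  then have int: "integrable (measure_pmf (value_law I)) f" for f :: "(nat \<Rightarrow> real) \<Rightarrow> real"
    by (rule integrable_measure_pmf_finite)
  have "leader_objective I X b = (\<Sum>i<num_items I.
      measure_pmf.expectation (value_law I) (\<lambda>c. real_of_int (leader_values I ! i) * X b c i)) - delta I * b"
    unfolding leader_objective_def using int
    by (subst Bochner_Integration.integral_diff) (simp_all add: Bochner_Integration.integral_sum)
  also have "(\<Sum>i<num_items I.
      measure_pmf.expectation (value_law I) (\<lambda>c. real_of_int (leader_values I ! i) * X b c i)) =
      (\<Sum>i<num_items I. \<Sum>s\<le>total_size I.
        (\<Sum>k<length (laws I ! i). kink_term I i k s) * max 0 (b - real s))"
    using I X b by (intro sum.cong expectation_item) auto
  also have "\<dots> = ramp_sum I b"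
    unfolding ramp_sum_def kink_def by (subst sum.swap) (simp add: sum_distrib_right)
  finally show ?thesis .
qed

section \<open>Affine pieces of the objective and clamped integers\<close>

lemma ramp_sum_affine:
  assumes "real u \<le> y" "y \<le> real u + 1" "real u \<le> z" "z \<le> real u + 1"
    and "z \<le> real (total_size I)" "y \<le> real (total_size I)"
  shows "ramp_sum I z - ramp_sum I y = (\<Sum>s\<le>u. kink I s) * (z - y)"
proof -
  let ?A = "total_size I"
  have "ramp_sum I z - ramp_sum I y =
      (\<Sum>s\<le>?A. kink I s * (max 0 (z - real s) - max 0 (y - real s)))"
    by (simp add: ramp_sum_def algebra_simps sum_subtractf)
  \<comment> \<open>Both points lie between \<open>u\<close> and \<open>u + 1\<close>: ramps
    starting at \<open>s \<le> u\<close> are linear there, and those starting at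
    \<open>u + 1\<close> or later are 0.\<close>
  also have "\<dots> = (\<Sum>s\<le>?A. if s \<le> u then kink I s * (z - y) else 0)"
  proof (intro sum.cong refl)
    fix s
    show "kink I s * (max 0 (z - real s) - max 0 (y - real s)) =
        (if s \<le> u then kink I s * (z - y) else 0)"
    proof (cases "s \<le> u")
      case True
      then have "real s \<le> real u" by simp
      then show ?thesis using True assms by simp
    next
      case False
      then have "real u + 1 \<le> real s" by linarith
      then show ?thesis using False assms by simp
    qed
  qed
  also have "\<dots> = (\<Sum>s\<le>u. kink I s * (z - y))"
  proof -
    have "u \<le> ?A" using assms by linarith
    then show ?thesis
      by (subst sum.inter_filter[symmetric]) (auto intro!: sum.cong)
  qed
  finally show ?thesis by (simp add: sum_distrib_right)
qed

text \<open>The argument is real so that the scan can start from \<open>-1\<close>, which is clamped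
  to the lower end.\<close>

definition clamp_cap :: "sp_instance \<Rightarrow> real \<Rightarrow> real" where
  "clamp_cap I u = max (b_min I) (min (b_max I) u)"

text \<open>The update formula of the scan. If clamping identifies the two points, the increment is
  0 whatever the slope is; otherwise both lie between \<open>u - 1\<close> and \<open>u\<close>,
  where only kinks at \<open>s < u\<close> contribute.\<close>

lemma ramp_sum_clamp_step:
  assumes I: "valid_instance I"
  shows "ramp_sum I (clamp_cap I (real u)) = ramp_sum I (clamp_cap I (real u - 1)) +
    (\<Sum>s<u. kink I s) * (clamp_cap I (real u) - clamp_cap I (real u - 1))"
proof (cases "clamp_cap I (real u) = clamp_cap I (real u - 1)")
  case False
  have b: "0 \<le> b_min I" "b_min I \<le> b_max I" "b_max I \<le> real (total_size I)"
    using I by (auto simp: valid_instance_def)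
  then obtain w where u: "u = Suc w"
    using False by (cases u) (auto simp: clamp_cap_def)
  have "ramp_sum I (clamp_cap I (real u)) - ramp_sum I (clamp_cap I (real u - 1)) =
      (\<Sum>s\<le>w. kink I s) * (clamp_cap I (real u) - clamp_cap I (real u - 1))"
    using False b unfolding u
    by (intro ramp_sum_affine) (auto simp: clamp_cap_def max_def min_def split: if_splits)
  then show ?thesis by (simp add: u lessThan_Suc_atMost)
qed simp

text \<open>
  The objective is affine between consecutive integers, so its maximum is attained at an integer
  or at an end point of the interval, that is, at an integer clamped to the interval.
\<close>

lemma sp_solution_clamp:
  assumes I: "valid_instance I" and b: "b \<in> {b_min I..b_max I}"
    and v: "v = ramp_sum I b - delta I * b"
    and max: "\<And>u. u \<le> total_size I \<Longrightarrow>
      ramp_sum I (clamp_cap I (real u)) - delta I * clamp_cap I (real u) \<le> v"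
  shows "sp_solution I b v"
proof -
  have bb: "0 \<le> b_min I" "b_min I \<le> b_max I" "b_max I \<le> real (total_size I)"
    using I by (auto simp: valid_instance_def)
  have le: "ramp_sum I x - delta I * x \<le> v" if x: "x \<in> {b_min I..b_max I}" for x
  proof -
    define u where "u = nat \<lfloor>x\<rfloor>"
    have x0: "0 \<le> x" using x bb by auto
    then have u: "real u \<le> x" "x < real u + 1"
      unfolding u_def by linarith+
    show ?thesis
    proof (cases "u < total_size I")
      case False
      then have "x = real (total_size I)" "clamp_cap I (real (total_size I)) = x"
        using u x bb by (auto simp: clamp_cap_def)
      then show ?thesis using max[of "total_size I"] by simp
    next
      case True
      define y z where "y = clamp_cap I (real u)" and "z = clamp_cap I (real (Suc u))"
      have yz: "real u \<le> y" "y \<le> x" "x \<le> z" "z \<le> real u + 1" "z \<le> b_max I"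
        using u x bb by (auto simp: y_def z_def clamp_cap_def)
      \<comment> \<open>The slope of the objective between \<open>y\<close> and \<open>z\<close>: if
        it is nonnegative, \<open>z\<close> is at least as good as \<open>x\<close>, otherwise
        \<open>y\<close> is.\<close>
      define m where "m = (\<Sum>s\<le>u. kink I s) - delta I"
      have "ramp_sum I x - ramp_sum I y = (\<Sum>s\<le>u. kink I s) * (x - y)"
           "ramp_sum I z - ramp_sum I x = (\<Sum>s\<le>u. kink I s) * (z - x)"
        using yz u x bb by (auto intro!: ramp_sum_affine)
      then have "ramp_sum I x - delta I * x = ramp_sum I y - delta I * y + m * (x - y)"
        "ramp_sum I x - delta I * x = ramp_sum I z - delta I * z - m * (z - x)"
        by (auto simp: m_def algebra_simps)
      moreover have "ramp_sum I y - delta I * y \<le> v" "ramp_sum I z - delta I * z \<le> v"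
        using max[of u] max[of "Suc u"] True by (auto simp: y_def z_def)
      moreover have "m * (x - y) \<le> 0 \<or> m * (z - x) \<ge> 0"
        using yz by (cases "m \<ge> 0") (auto simp: mult_nonpos_nonneg)
      ultimately show ?thesis by linarith
    qed
  qed
  show ?thesis
    unfolding sp_solution_def is_arg_max_linorder
    using leader_objective_eq[OF I] le b v by auto
qed

section \<open>Timed total correctness\<close>

definition runs :: "com \<Rightarrow> ram_state \<Rightarrow> nat \<Rightarrow> (ram_state \<Rightarrow> bool) \<Rightarrow> bool" where
  "runs p s T Q \<longleftrightarrow> (\<exists>t s'. exec p s t s' \<and> t \<le> T \<and> Q s')"

fun writes :: "com \<Rightarrow> string set" where
  "writes Skip = {}"
| "writes (NWrite x k e) = {x}"
| "writes (RWrite x k e) = {x}"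
| "writes (Seq p q) = writes p \<union> writes q"
| "writes (Cond g p q) = writes p \<union> writes q"
| "writes (While g p) = writes p"

definition agree_off :: "string set \<Rightarrow> ram_state \<Rightarrow> ram_state \<Rightarrow> bool" where
  "agree_off W s s' \<longleftrightarrow>
     (\<forall>x. x \<notin> W \<longrightarrow> nat_mem s' x = nat_mem s x \<and> real_mem s' x = real_mem s x)"

lemma agree_off_nat: "agree_off W s s' \<Longrightarrow> x \<notin> W \<Longrightarrow> nat_mem s' x = nat_mem s x"
  and agree_off_real: "agree_off W s s' \<Longrightarrow> x \<notin> W \<Longrightarrow> real_mem s' x = real_mem s x"
  by (auto simp: agree_off_def)

lemma nat_mem_nat_write [simp]:
  "nat_mem (nat_write x k v s) y = (if y = x then (nat_mem s x)(k := v) else nat_mem s y)"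
  by (simp add: nat_write_def)

lemma real_mem_nat_write [simp]: "real_mem (nat_write x k v s) = real_mem s"
  by (simp add: nat_write_def)

lemma real_mem_real_write [simp]:
  "real_mem (real_write x k v s) y = (if y = x then (real_mem s x)(k := v) else real_mem s y)"
  by (simp add: real_write_def)

lemma nat_mem_real_write [simp]: "nat_mem (real_write x k v s) = nat_mem s"
  by (simp add: real_write_def)

lemma exec_agree_off: "exec p s t s' \<Longrightarrow> agree_off (writes p) s s'"
  by (induction rule: exec.induct) (auto simp: agree_off_def)

text \<open>The frame rule: postconditions need to mention only what a program computes, since
  preservation of everything else follows from its syntax.\<close>

lemma runs_frame: "runs p s T Q \<Longrightarrow> runs p s T (\<lambda>s'. agree_off (writes p) s s' \<and> Q s')"
  unfolding runs_def using exec_agree_off by blast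

lemma runs_mono: "runs p s T Q \<Longrightarrow> T \<le> T' \<Longrightarrow> (\<And>s'. Q s' \<Longrightarrow> Q' s') \<Longrightarrow> runs p s T' Q'"
  unfolding runs_def by (meson le_trans)

lemma runs_Skip: "Q s \<Longrightarrow> 1 \<le> T \<Longrightarrow> runs Skip s T Q"
  unfolding runs_def using exec.Skip by blast

lemma runs_NWrite:
  "Q (nat_write x (nval k s) (nval e s) s) \<Longrightarrow> 1 + ncost k + ncost e \<le> T \<Longrightarrow>
    runs (NWrite x k e) s T Q"
  unfolding runs_def using exec.NWrite by blast

lemma runs_RWrite:
  "Q (real_write x (nval k s) (rval e s) s) \<Longrightarrow> 1 + ncost k + rcost e \<le> T \<Longrightarrow>
    runs (RWrite x k e) s T Q"
  unfolding runs_def using exec.RWrite by blast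

lemma runs_Seq:
  assumes "runs p s T1 (\<lambda>s'. runs q s' T2 Q)" "T1 + T2 \<le> T"
  shows "runs (Seq p q) s T Q"
proof -
  obtain t s' u s'' where "exec p s t s'" "t \<le> T1" "exec q s' u s''" "u \<le> T2" "Q s''"
    using assms(1) by (auto simp: runs_def)
  then show ?thesis
    unfolding runs_def using exec.Seq assms(2) by (intro exI[of _ "t + u"] exI[of _ s'']) auto
qed

lemma runs_Cond:
  assumes "bval g s \<Longrightarrow> runs p s T' Q" "\<not> bval g s \<Longrightarrow> runs q s T' Q" "1 + bcost g + T' \<le> T"
  shows "runs (Cond g p q) s T Q"
proof (cases "bval g s")
  case True
  then obtain t s' where "exec p s t s'" "t \<le> T'" "Q s'"
    using assms(1) by (auto simp: runs_def)
  then show ?thesis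
    unfolding runs_def using exec.CondTrue[OF True] assms(3)
    by (intro exI[of _ "1 + bcost g + t"] exI[of _ s']) auto
next
  case False
  then obtain t s' where "exec q s t s'" "t \<le> T'" "Q s'"
    using assms(2) by (auto simp: runs_def)
  then show ?thesis
    unfolding runs_def using exec.CondFalse[OF False] assms(3)
    by (intro exI[of _ "1 + bcost g + t"] exI[of _ s']) auto
qed

abbreviation NVar :: "string \<Rightarrow> nexp" where "NVar x \<equiv> NRead x (NConst 0)"
abbreviation RVar :: "string \<Rightarrow> rexp" where "RVar x \<equiv> RRead x (NConst 0)"

definition For :: "string \<Rightarrow> nexp \<Rightarrow> com \<Rightarrow> com" where
  "For x e p = Seq (NWrite x (NConst 0) (NConst 0))
     (While (NLess (NVar x) e) (Seq p (NWrite x (NConst 0) (NAdd (NVar x) (NConst 1)))))"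

lemma writes_For [simp]: "writes (For x e p) = insert x (writes p)"
  by (auto simp: For_def)

text \<open>
  The crude time bound absorbs the loop overhead into a factor, so nested loops give plain products.
\<close>

lemma runs_For:
  assumes x: "x \<notin> writes p"
    and bound: "\<And>s. agree_off (insert x (writes p)) s0 s \<Longrightarrow> nval e s = N"
    and init: "Inv 0 (nat_write x 0 0 s0)"
    and step: "\<And>k s. k < N \<Longrightarrow> agree_off (insert x (writes p)) s0 s \<Longrightarrow> nat_mem s x 0 = k \<Longrightarrow>
      Inv k s \<Longrightarrow> runs p s T (\<lambda>s'. Inv (Suc k) (nat_write x 0 (Suc k) s'))"
    and N: "N \<le> N'" "1 \<le> N'" and T: "1 \<le> T" and e: "ncost e \<le> 6"
  shows "runs (For x e p) s0 (33 * (N' * T)) (Inv N)"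
proof -
  let ?W = "insert x (writes p)"
  let ?w = "While (NLess (NVar x) e) (Seq p (NWrite x (NConst 0) (NAdd (NVar x) (NConst 1))))"
  \<comment> \<open>Evaluating the loop test costs at most \<open>1 + (1 + 2 + 6) = 10\<close> and
    the increment costs 6. This gives the overhead 16 per round and 10 for the final failing
    test.\<close>
  have *: "runs ?w s (r * (T + 16) + 10) (Inv N)"
    if "r + k = N" "agree_off ?W s0 s" "nat_mem s x 0 = k" "Inv k s" for r k s
    using that
  proof (induction r arbitrary: k s)
    case 0
    then have "\<not> bval (NLess (NVar x) e) s"
      using bound by simp
    from exec.WhileFalse[OF this] show ?case
      using 0 e unfolding runs_def by fastforce
  next
    case (Suc r)
    then have g: "bval (NLess (NVar x) e) s"
      using bound by simp
    have "runs p s T (\<lambda>s'. Inv (Suc k) (nat_write x 0 (Suc k) s'))"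
      using Suc.prems by (intro step) auto
    then obtain t s' where s': "exec p s t s'" "t \<le> T" "Inv (Suc k) (nat_write x 0 (Suc k) s')"
      by (auto simp: runs_def)
    let ?s = "nat_write x 0 (Suc k) s'"
    have a: "agree_off (writes p) s s'"
      using s'(1) by (rule exec_agree_off)
    then have k: "nat_mem s' x 0 = k"
      using Suc.prems x by (simp add: agree_off_def)
    have inc: "exec (NWrite x (NConst 0) (NAdd (NVar x) (NConst 1))) s' 6 ?s"
      using exec.NWrite[of x "NConst 0" "NAdd (NVar x) (NConst 1)" s'] k
      by (simp add: numeral_eq_Suc)
    have "agree_off ?W s0 ?s"
      using a Suc.prems(2) unfolding agree_off_def by (auto simp: nat_write_def)
    then have "runs ?w ?s (r * (T + 16) + 10) (Inv N)"
      using Suc.prems(1) s'(3) by (intro Suc.IH[of "Suc k"]) auto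
    then obtain u s'' where u: "exec ?w ?s u s''" "u \<le> r * (T + 16) + 10" "Inv N s''"
      by (auto simp: runs_def)
    show ?case
      unfolding runs_def
      using exec.WhileTrue[OF g exec.Seq[OF s'(1) inc] u(1)] u(2,3) s'(2) e
      by (intro exI[of _ "1 + bcost (NLess (NVar x) e) + (t + 6) + u"] exI[of _ s'']) auto
  qed
  have "runs ?w (nat_write x 0 0 s0) (N * (T + 16) + 10) (Inv N)"
    using init by (intro *[of N 0]) (auto simp: agree_off_def)
  then have "runs (For x e p) s0 (3 + (N * (T + 16) + 10)) (Inv N)"
    unfolding For_def by (intro runs_Seq runs_NWrite) auto
  \<comment> \<open>As \<open>T\<close> and \<open>N'\<close> are at least 1, the rounds cost at
    most \<open>17 * (N' * T)\<close> and the remaining 13 units at most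
    \<open>13 * (N' * T)\<close>.\<close>
  moreover have "3 + (N * (T + 16) + 10) \<le> 33 * (N' * T)"
  proof -
    have "N * (T + 16) \<le> N' * (17 * T)"
      using N T by (intro mult_mono) auto
    moreover have "1 \<le> N' * T" using N T by simp
    ultimately show ?thesis by linarith
  qed
  ultimately show ?thesis
    by (rule runs_mono) auto
qed


lemma runs_Seq_frame:
  assumes "runs p s T1 R" "\<And>s'. agree_off (writes p) s s' \<Longrightarrow> R s' \<Longrightarrow> runs q s' T2 Q" "T1 + T2 \<le> T"
  shows "runs (Seq p q) s T Q"
proof (rule runs_Seq[OF _ assms(3)])
  show "runs p s T1 (\<lambda>s'. runs q s' T2 Q)"
    using runs_frame[OF assms(1)] by (rule runs_mono) (auto intro: assms(2))
qed

section \<open>The program\<close>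

text \<open>
  Cell \<open>q\<close> points to the current value of item \<open>i\<close> in the arrays \<open>c\<close> and \<open>p\<close>, and \<open>o\<close> to the
  current value of item \<open>j\<close>. Array \<open>P\<close> holds \<open>load_dist\<close>, \<open>R\<close> is its buffer, \<open>D\<close> accumulates
  \<open>kink\<close>, and in the final scan \<open>H\<close> and \<open>slope\<close> are the value at \<open>x\<close> and the slope of \<open>ramp_sum\<close>.
\<close>

definition offset :: "sp_instance \<Rightarrow> nat \<Rightarrow> nat" where
  "offset I i = (\<Sum>j<i. length (laws I ! j))"

definition holds_input :: "sp_instance \<Rightarrow> ram_state \<Rightarrow> bool" where
  "holds_input I s \<longleftrightarrow> nat_mem s ''n'' 0 = num_items I \<and>
     (\<forall>i<num_items I. nat_mem s ''a'' i = sizes I ! i \<and>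
        nat_mem s ''m'' i = length (laws I ! i) \<and>
        real_mem s ''d'' i = real_of_int (leader_values I ! i) \<and>
        (\<forall>k<length (laws I ! i). real_mem s ''c'' (offset I i + k) = fst (laws I ! i ! k) \<and>
           real_mem s ''p'' (offset I i + k) = snd (laws I ! i ! k))) \<and>
     real_mem s ''delta'' 0 = delta I \<and> real_mem s ''b_min'' 0 = b_min I \<and>
     real_mem s ''b_max'' 0 = b_max I"

definition ready :: "sp_instance \<Rightarrow> ram_state \<Rightarrow> bool" where
  "ready I s \<longleftrightarrow> holds_input I s \<and> nat_mem s ''A'' 0 = total_size I"

definition input_names :: "string set" where
  "input_names = {''n'', ''a'', ''m'', ''d'', ''c'', ''p'', ''delta'', ''b_min'', ''b_max''}"

lemma holds_input_agree:
  assumes "holds_input I s" "agree_off W s s'" "W \<inter> input_names = {}"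
  shows "holds_input I s'"
proof -
  have "nat_mem s' ''n'' = nat_mem s ''n''" "nat_mem s' ''a'' = nat_mem s ''a''"
    "nat_mem s' ''m'' = nat_mem s ''m''"
    by (rule agree_off_nat[OF assms(2)], use assms(3) in \<open>auto simp: input_names_def\<close>)+
  moreover have "real_mem s' ''d'' = real_mem s ''d''" "real_mem s' ''c'' = real_mem s ''c''"
    "real_mem s' ''p'' = real_mem s ''p''" "real_mem s' ''delta'' = real_mem s ''delta''"
    "real_mem s' ''b_min'' = real_mem s ''b_min''" "real_mem s' ''b_max'' = real_mem s ''b_max''"
    by (rule agree_off_real[OF assms(2)], use assms(3) in \<open>auto simp: input_names_def\<close>)+
  ultimately show ?thesis
    using assms(1) unfolding holds_input_def by simp
qed

lemma ready_agree:
  assumes "ready I s" "agree_off W s s'" "W \<inter> insert ''A'' input_names = {}"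
  shows "ready I s'"
proof -
  have "holds_input I s'"
    using assms by (intro holds_input_agree[of I s W s']) (auto simp: ready_def)
  moreover have "nat_mem s' ''A'' = nat_mem s ''A''"
    using assms by (intro agree_off_nat) auto
  ultimately show ?thesis
    using assms(1) by (simp add: ready_def)
qed

lemma nth_concat_offset:
  "i < length xss \<Longrightarrow> k < length (xss ! i) \<Longrightarrow>
    (\<Sum>j<i. length (xss ! j)) + k < length (concat xss) \<and>
    concat xss ! ((\<Sum>j<i. length (xss ! j)) + k) = xss ! i ! k"
proof (induction xss arbitrary: i)
  case (Cons xs xss)
  show ?case
  proof (cases i)
    case 0
    then show ?thesis using Cons.prems by (simp add: nth_append)
  next
    case (Suc i')
    then show ?thesis
      using Cons.IH[of i'] Cons.prems
      by (simp add: sum.lessThan_Suc_shift nth_append add.assoc del: sum.lessThan_Suc)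
  qed
qed simp

lemma holds_input_encode:
  assumes "valid_instance I"
  shows "holds_input I (encode I)"
proof -
  have len: "length (leader_values I) = num_items I" "length (laws I) = num_items I"
    "length (sizes I) = num_items I"
    using assms by (auto simp: valid_instance_def num_items_def)
  have "offset I i + k < length (concat (laws I)) \<and>
      concat (laws I) ! (offset I i + k) = laws I ! i ! k"
    if "i < num_items I" "k < length (laws I ! i)" for i k
    unfolding offset_def using that len by (intro nth_concat_offset) auto
  then show ?thesis
    using len by (simp add: holds_input_def encode_def list_mem_def)
qed

section \<open>Total size and the probabilities of being packed earlier\<close>

definition size_prog :: com where
  "size_prog = For ''j'' (NVar ''n'')
     (NWrite ''A'' (NConst 0) (NAdd (NVar ''A'') (NRead ''a'' (NVar ''j''))))"

lemma writes_size_prog: "writes size_prog = {''j'', ''A''}"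
  by (simp add: size_prog_def)

lemma runs_size_prog:
  assumes I: "valid_instance I" and s0: "holds_input I s0" "nat_mem s0 ''A'' 0 = 0"
  shows "runs size_prog s0 (400 * num_items I) (ready I)"
proof -
  have n: "1 \<le> num_items I"
    using I by (simp add: valid_instance_def)
  have "runs size_prog s0 (33 * (num_items I * 10))
      (\<lambda>s. nat_mem s ''A'' 0 = (\<Sum>j<num_items I. sizes I ! j))"
    unfolding size_prog_def
  proof (rule runs_For[where N = "num_items I" and
      Inv = "\<lambda>k s. nat_mem s ''A'' 0 = (\<Sum>j<k. sizes I ! j)"], goal_cases)
    case (2 s)
    then show ?case using s0 by (simp add: agree_off_nat holds_input_def)
  next
    case (4 k s)
    then have "holds_input I s"
      using holds_input_agree[OF s0(1) 4(2)] by (simp add: input_names_def)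
    then show ?case
      using 4 by (intro runs_NWrite) (simp_all add: holds_input_def)
  qed (use s0 n in auto)
  then have "runs size_prog s0 (33 * (num_items I * 10)) (\<lambda>s. agree_off (writes size_prog) s0 s \<and>
      nat_mem s ''A'' 0 = (\<Sum>j<num_items I. sizes I ! j))"
    by (rule runs_frame)
  then show ?thesis
  proof (rule runs_mono)
    fix s
    assume "agree_off (writes size_prog) s0 s \<and> nat_mem s ''A'' 0 = (\<Sum>j<num_items I. sizes I ! j)"
    then show "ready I s"
      using holds_input_agree[OF s0(1), of "writes size_prog" s]
      by (simp add: ready_def total_size_def writes_size_prog input_names_def)
  qed simp
qed

text \<open>The condition of \<open>better_prob\<close>. The machine only tests strict order, so
  \<open>j \<noteq> i\<close> is expressed by excluding that neither index is smaller.\<close>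

definition better_test :: bexp where
  "better_test =
     BAnd (RLess (RMul (RRead ''c'' (NVar ''q'')) (ROfNat (NRead ''a'' (NVar ''j''))))
                 (RMul (RRead ''c'' (NVar ''o'')) (ROfNat (NRead ''a'' (NVar ''i'')))))
          (BNot (BAnd (BNot (NLess (NVar ''i'') (NVar ''j'')))
                      (BNot (NLess (NVar ''j'') (NVar ''i'')))))"

definition prob_loop :: com where
  "prob_loop = For ''l'' (NRead ''m'' (NVar ''j''))
     (Seq (Cond better_test
            (RWrite ''Q'' (NConst 0) (RAdd (RVar ''Q'') (RRead ''p'' (NVar ''o''))))
            Skip)
          (NWrite ''o'' (NConst 0) (NAdd (NVar ''o'') (NConst 1))))"

definition prob_prog :: com where
  "prob_prog = Seq (RWrite ''Q'' (NConst 0) (ROfNat (NConst 0))) prob_loop"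

lemma writes_prob_prog: "writes prob_prog = {''Q'', ''l'', ''o''}"
  by (auto simp: prob_prog_def prob_loop_def)

text \<open>The pointer \<open>o\<close> moves along with the law of item \<open>j\<close> and ends
  at the law of item \<open>j + 1\<close>, so offsets are never recomputed. One round costs at most
  49 for the conditional and 6 for advancing \<open>o\<close>.\<close>

lemma runs_prob_loop:
  assumes s0: "ready I s0" and i: "i < num_items I" "nat_mem s0 ''i'' 0 = i"
    and j: "j < num_items I" "nat_mem s0 ''j'' 0 = j"
    and v: "real_mem s0 ''c'' (nat_mem s0 ''q'' 0) = v"
    and o: "nat_mem s0 ''o'' 0 = offset I j" and Q: "real_mem s0 ''Q'' 0 = 0"
    and m: "length (laws I ! j) \<le> m" "1 \<le> m"
  shows "runs prob_loop s0 (33 * (m * 55))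
    (\<lambda>s. real_mem s ''Q'' 0 = better_prob I i v j \<and> nat_mem s ''o'' 0 = offset I (Suc j))"
proof -
  let ?g = "\<lambda>l. v * real (sizes I ! j) < fst (laws I ! j ! l) * real (sizes I ! i) \<and> j \<noteq> i"
  let ?t = "\<lambda>l. if ?g l then snd (laws I ! j ! l) else 0"
  let ?Inv = "\<lambda>l s. real_mem s ''Q'' 0 = (\<Sum>l<l. ?t l) \<and> nat_mem s ''o'' 0 = offset I j + l"
  have "runs prob_loop s0 (33 * (m * 55)) (?Inv (length (laws I ! j)))"
    unfolding prob_loop_def
  proof (rule runs_For[where N = "length (laws I ! j)" and Inv = ?Inv], goal_cases)
    case (2 s)
    then have "nat_mem s ''j'' 0 = j" "nat_mem s ''m'' j = length (laws I ! j)"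
      using j s0 by (auto simp: agree_off_nat ready_def holds_input_def)
    then show ?case by simp
  next
    case 3
    then show ?case using o Q by simp
  next
    case (4 l s)
    then have r: "ready I s"
      by (intro ready_agree[OF s0 4(2)]) (simp add: input_names_def)
    have eqs: "nat_mem s ''i'' 0 = i" "nat_mem s ''j'' 0 = j"
      "real_mem s ''c'' (nat_mem s ''q'' 0) = v"
      using 4(2) i j v by (auto simp: agree_off_nat agree_off_real)
    have dat: "nat_mem s ''a'' i = sizes I ! i" "nat_mem s ''a'' j = sizes I ! j"
      "real_mem s ''c'' (offset I j + l) = fst (laws I ! j ! l)"
      "real_mem s ''p'' (offset I j + l) = snd (laws I ! j ! l)"
      using r i j 4(1) by (auto simp: ready_def holds_input_def)
    have inv: "real_mem s ''Q'' 0 = (\<Sum>l<l. ?t l)" "nat_mem s ''o'' 0 = offset I j + l"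
      using 4 by auto
    have g: "bval better_test s \<longleftrightarrow> ?g l"
      using eqs dat inv unfolding better_test_def by auto
    have cost: "bcost better_test \<le> 38"
      by (simp add: better_test_def)
    have "runs (Cond better_test
            (RWrite ''Q'' (NConst 0) (RAdd (RVar ''Q'') (RRead ''p'' (NVar ''o''))))
            Skip) s 49
        (\<lambda>s'. real_mem s' ''Q'' 0 = (\<Sum>l<Suc l. ?t l) \<and> nat_mem s' ''o'' 0 = offset I j + l)"
    proof (rule runs_Cond[where T' = 10])
      assume "bval better_test s"
      then have "?g l" using g by blast
      then show "runs (RWrite ''Q'' (NConst 0) (RAdd (RVar ''Q'') (RRead ''p'' (NVar ''o'')))) s 10
          (\<lambda>s'. real_mem s' ''Q'' 0 = (\<Sum>l<Suc l. ?t l) \<and> nat_mem s' ''o'' 0 = offset I j + l)"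
        using inv dat by (intro runs_RWrite) auto
    next
      assume "\<not> bval better_test s"
      then have "\<not> ?g l" using g by blast
      then show "runs Skip s 10
          (\<lambda>s'. real_mem s' ''Q'' 0 = (\<Sum>l<Suc l. ?t l) \<and> nat_mem s' ''o'' 0 = offset I j + l)"
        using inv by (intro runs_Skip) auto
    qed (use cost in simp)
    then show ?case
      by (rule runs_Seq_frame[where ?T2.0 = 6]) (auto intro!: runs_NWrite)
  qed (use m in auto)
  then show ?thesis
    by (rule runs_mono) (simp_all add: better_prob_def offset_def)
qed

lemma runs_prob_prog:
  assumes s0: "ready I s0" and i: "i < num_items I" "nat_mem s0 ''i'' 0 = i"
    and j: "j < num_items I" "nat_mem s0 ''j'' 0 = j"
    and v: "real_mem s0 ''c'' (nat_mem s0 ''q'' 0) = v"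
    and o: "nat_mem s0 ''o'' 0 = offset I j"
    and m: "length (laws I ! j) \<le> m" "1 \<le> m"
  shows "runs prob_prog s0 (2000 * m)
    (\<lambda>s. real_mem s ''Q'' 0 = better_prob I i v j \<and> nat_mem s ''o'' 0 = offset I (Suc j))"
  unfolding prob_prog_def
proof (rule runs_Seq_frame[where ?T1.0 = 4 and ?T2.0 = "33 * (m * 55)" and R = "\<lambda>s. real_mem s ''Q'' 0 = 0"])
  fix s assume s: "agree_off (writes (RWrite ''Q'' (NConst 0) (ROfNat (NConst 0)))) s0 s"
    and Q: "real_mem s ''Q'' 0 = 0"
  have "ready I s"
    by (rule ready_agree[OF s0 s]) (simp add: input_names_def)
  then show "runs prob_loop s (33 * (m * 55))
    (\<lambda>s. real_mem s ''Q'' 0 = better_prob I i v j \<and> nat_mem s ''o'' 0 = offset I (Suc j))"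
    using i j v o m Q s by (intro runs_prob_loop) (auto simp: agree_off_nat agree_off_real)
qed (use m in \<open>auto intro!: runs_RWrite\<close>)

section \<open>The distribution of the load by repeated convolution\<close>

definition mix_prog :: com where
  "mix_prog = For ''s'' (NAdd (NVar ''A'') (NConst 1))
     (Cond (NLess (NVar ''s'') (NRead ''a'' (NVar ''j'')))
       (RWrite ''R'' (NVar ''s'')
         (RMul (RRead ''P'' (NVar ''s'')) (RSub (ROfNat (NConst 1)) (RVar ''Q''))))
       (RWrite ''R'' (NVar ''s'')
         (RAdd (RMul (RRead ''P'' (NVar ''s'')) (RSub (ROfNat (NConst 1)) (RVar ''Q'')))
           (RMul (RRead ''P'' (NSub (NVar ''s'') (NRead ''a'' (NVar ''j'')))) (RVar ''Q'')))))"

text \<open>The convolution goes through the buffer \<open>R\<close> because an ascending update of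
  \<open>P\<close> in place would destroy entries that later cells still have to read.\<close>

definition copy_prog :: com where
  "copy_prog = For ''s'' (NAdd (NVar ''A'') (NConst 1))
     (RWrite ''P'' (NVar ''s'') (RRead ''R'' (NVar ''s'')))"

lemma writes_mix_prog: "writes mix_prog = {''s'', ''R''}"
  by (auto simp: mix_prog_def)

lemma writes_copy_prog: "writes copy_prog = {''s'', ''P''}"
  by (auto simp: copy_prog_def)

lemma runs_mix_prog:
  assumes s0: "ready I s0" and j: "j < num_items I" "nat_mem s0 ''j'' 0 = j"
    and Q: "real_mem s0 ''Q'' 0 = Q" and P: "\<forall>x\<le>total_size I. real_mem s0 ''P'' x = f x"
  shows "runs mix_prog s0 (1320 * Suc (total_size I)) (\<lambda>s. \<forall>x\<le>total_size I.
    real_mem s ''R'' x = f x * (1 - Q) + shifted (sizes I ! j) f x * Q)"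
proof -
  let ?A = "total_size I" and ?g = "\<lambda>x. f x * (1 - Q) + shifted (sizes I ! j) f x * Q"
  let ?Inv = "\<lambda>k s. \<forall>x<k. real_mem s ''R'' x = ?g x"
  have "runs mix_prog s0 (33 * (Suc ?A * 40)) (?Inv (Suc ?A))"
    unfolding mix_prog_def
  proof (rule runs_For[where N = "Suc ?A" and Inv = ?Inv], goal_cases)
    case (2 s)
    then show ?case using s0 by (simp add: agree_off_nat ready_def)
  next
    case (4 k s)
    then have r: "ready I s"
      by (intro ready_agree[OF s0 4(2)]) (simp add: input_names_def)
    have eqs: "nat_mem s ''j'' 0 = j" "real_mem s ''Q'' 0 = Q"
      "\<And>x. x \<le> ?A \<Longrightarrow> real_mem s ''P'' x = f x"
      using 4(2) j Q P by (auto simp: agree_off_nat agree_off_real)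
    have dat: "nat_mem s ''a'' j = sizes I ! j"
      using r j by (auto simp: ready_def holds_input_def)
    show ?case
      using 4 eqs dat
      by (intro runs_Cond[where T' = 30] runs_RWrite) (auto simp: less_Suc_eq shifted_def)
  qed auto
  then show ?thesis
    by (rule runs_mono) auto
qed

lemma runs_copy_prog:
  assumes s0: "ready I s0" and R: "\<forall>x\<le>total_size I. real_mem s0 ''R'' x = f x"
  shows "runs copy_prog s0 (1320 * Suc (total_size I))
    (\<lambda>s. \<forall>x\<le>total_size I. real_mem s ''P'' x = f x)"
proof -
  let ?A = "total_size I"
  let ?Inv = "\<lambda>k s. \<forall>x<k. real_mem s ''P'' x = f x"
  have "runs copy_prog s0 (33 * (Suc ?A * 40)) (?Inv (Suc ?A))"
    unfolding copy_prog_def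
  proof (rule runs_For[where N = "Suc ?A" and Inv = ?Inv], goal_cases)
    case (2 s)
    then show ?case using s0 by (simp add: agree_off_nat ready_def)
  next
    case (4 k s)
    then have "real_mem s ''R'' = real_mem s0 ''R''"
      by (simp add: agree_off_real)
    then show ?case
      using 4 R by (intro runs_RWrite) (auto simp: less_Suc_eq)
  qed auto
  then show ?thesis
    by (rule runs_mono) auto
qed

definition init_prog :: com where
  "init_prog = Seq (NWrite ''o'' (NConst 0) (NConst 0))
    (For ''s'' (NAdd (NVar ''A'') (NConst 1))
      (Cond (NLess (NConst 0) (NVar ''s''))
        (RWrite ''P'' (NVar ''s'') (ROfNat (NConst 0)))
        (RWrite ''P'' (NVar ''s'') (ROfNat (NConst 1)))))"

lemma writes_init_prog: "writes init_prog = {''o'', ''s'', ''P''}"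
  by (auto simp: init_prog_def)

lemma runs_init_prog:
  assumes s0: "ready I s0"
  shows "runs init_prog s0 (1000 * Suc (total_size I)) (\<lambda>s. nat_mem s ''o'' 0 = offset I 0 \<and>
    (\<forall>x\<le>total_size I. real_mem s ''P'' x = load_dist I i v 0 x))"
  unfolding init_prog_def
proof (rule runs_Seq_frame[where ?T1.0 = 3 and R = "\<lambda>s. nat_mem s ''o'' 0 = 0"])
  fix s1 assume s1: "agree_off (writes (NWrite ''o'' (NConst 0) (NConst 0))) s0 s1"
    and o: "nat_mem s1 ''o'' 0 = 0"
  let ?A = "total_size I"
  let ?Inv = "\<lambda>k s. nat_mem s ''o'' 0 = 0 \<and> (\<forall>x<k. real_mem s ''P'' x = load_dist I i v 0 x)"
  have "ready I s1"
    by (rule ready_agree[OF s0 s1]) (simp add: input_names_def)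
  have "runs (For ''s'' (NAdd (NVar ''A'') (NConst 1))
      (Cond (NLess (NConst 0) (NVar ''s''))
        (RWrite ''P'' (NVar ''s'') (ROfNat (NConst 0)))
        (RWrite ''P'' (NVar ''s'') (ROfNat (NConst 1))))) s1 (33 * (Suc ?A * 20)) (?Inv (Suc ?A))"
  proof (rule runs_For[where N = "Suc ?A" and Inv = ?Inv], goal_cases)
    case (2 s)
    then show ?case using \<open>ready I s1\<close> by (simp add: agree_off_nat ready_def)
  next
    case (4 k s)
    then show ?case
      by (intro runs_Cond[where T' = 10] runs_RWrite) (auto simp: less_Suc_eq)
  qed (use o in auto)
  then show "runs (For ''s'' (NAdd (NVar ''A'') (NConst 1))
      (Cond (NLess (NConst 0) (NVar ''s''))
        (RWrite ''P'' (NVar ''s'') (ROfNat (NConst 0)))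
        (RWrite ''P'' (NVar ''s'') (ROfNat (NConst 1))))) s1 (33 * (Suc ?A * 20))
      (\<lambda>s. nat_mem s ''o'' 0 = offset I 0 \<and>
        (\<forall>x\<le>total_size I. real_mem s ''P'' x = load_dist I i v 0 x))"
    by (rule runs_mono) (auto simp: offset_def)
qed (auto intro!: runs_NWrite)

definition dist_loop :: com where
  "dist_loop = For ''j'' (NVar ''n'') (Seq prob_prog (Seq mix_prog copy_prog))"

definition dist_prog :: com where
  "dist_prog = Seq init_prog dist_loop"

lemma writes_dist_prog: "writes dist_prog = {''o'', ''s'', ''P'', ''j'', ''Q'', ''l'', ''R''}"
  by (auto simp: dist_prog_def dist_loop_def writes_init_prog writes_prob_prog writes_mix_prog
      writes_copy_prog)

text \<open>Each item costs \<open>O(m)\<close> for its probability and \<open>O(A)\<close> for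
  convolution and copying. The invariant also fixes \<open>o\<close>, since the next round must find
  the law of its item there.\<close>

lemma runs_dist_loop:
  assumes s0: "ready I s0" and i: "i < num_items I" "nat_mem s0 ''i'' 0 = i"
    and v: "real_mem s0 ''c'' (nat_mem s0 ''q'' 0) = v"
    and o: "nat_mem s0 ''o'' 0 = offset I 0"
    and P: "\<forall>x\<le>total_size I. real_mem s0 ''P'' x = load_dist I i v 0 x"
    and m: "\<And>j. j < num_items I \<Longrightarrow> length (laws I ! j) \<le> m" "1 \<le> m"
  shows "runs dist_loop s0 (33 * (num_items I * (3000 * (m + Suc (total_size I)))))
    (\<lambda>s. \<forall>x\<le>total_size I. real_mem s ''P'' x = load_dist I i v (num_items I) x)"
proof -
  let ?A = "total_size I"
  let ?T = "3000 * (m + Suc ?A)"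
  let ?Inv = "\<lambda>j s. nat_mem s ''o'' 0 = offset I j \<and>
    (\<forall>x\<le>?A. real_mem s ''P'' x = load_dist I i v j x)"
  have "runs dist_loop s0 (33 * (num_items I * ?T)) (?Inv (num_items I))"
    unfolding dist_loop_def
  proof (rule runs_For[where N = "num_items I" and Inv = ?Inv], goal_cases)
    case (2 s)
    then show ?case using s0
      by (simp add: agree_off_nat ready_def holds_input_def writes_prob_prog writes_mix_prog writes_copy_prog)
  next
    case (4 j s)
    have W: "agree_off {''j'', ''o'', ''s'', ''P'', ''Q'', ''l'', ''R''} s0 s"
      using 4(2) by (simp add: agree_off_def writes_prob_prog writes_mix_prog writes_copy_prog)
    have r: "ready I s"
      by (rule ready_agree[OF s0 W]) (simp add: input_names_def)
    have eqs: "nat_mem s ''i'' 0 = i" "real_mem s ''c'' (nat_mem s ''q'' 0) = v"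
      using W i v by (auto simp: agree_off_nat agree_off_real)
    show ?case
    proof (rule runs_Seq_frame)
      show "runs prob_prog s (2000 * m)
          (\<lambda>s. real_mem s ''Q'' 0 = better_prob I i v j \<and> nat_mem s ''o'' 0 = offset I (Suc j))"
        using 4 r eqs i m by (intro runs_prob_prog) auto
    next
      fix s1 assume s1: "agree_off (writes prob_prog) s s1"
        "real_mem s1 ''Q'' 0 = better_prob I i v j \<and> nat_mem s1 ''o'' 0 = offset I (Suc j)"
      have r1: "ready I s1"
        by (rule ready_agree[OF r s1(1)]) (simp add: input_names_def writes_prob_prog)
      show "runs (Seq mix_prog copy_prog) s1 (2640 * Suc ?A)
          (\<lambda>s'. ?Inv (Suc j) (nat_write ''j'' 0 (Suc j) s'))"
      proof (rule runs_Seq_frame)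
        show "runs mix_prog s1 (1320 * Suc ?A) (\<lambda>s. \<forall>x\<le>?A. real_mem s ''R'' x =
            load_dist I i v j x * (1 - better_prob I i v j) +
            shifted (sizes I ! j) (load_dist I i v j) x * better_prob I i v j)"
          using 4 r1 s1 by (intro runs_mix_prog) (auto simp: agree_off_nat agree_off_real writes_prob_prog)
      next
        fix s2 assume s2: "agree_off (writes mix_prog) s1 s2"
          "\<forall>x\<le>?A. real_mem s2 ''R'' x =
            load_dist I i v j x * (1 - better_prob I i v j) +
            shifted (sizes I ! j) (load_dist I i v j) x * better_prob I i v j"
        have r2: "ready I s2"
          by (rule ready_agree[OF r1 s2(1)]) (simp add: input_names_def writes_mix_prog)
        have "nat_mem s2 ''o'' 0 = offset I (Suc j)"
          using s1 s2 by (simp add: agree_off_nat writes_mix_prog)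
        then show "runs copy_prog s2 (1320 * Suc ?A)
            (\<lambda>s'. ?Inv (Suc j) (nat_write ''j'' 0 (Suc j) s'))"
          using runs_frame[OF runs_copy_prog[OF r2 s2(2)]]
          by (elim runs_mono) (auto simp: writes_copy_prog agree_off_nat)
      qed simp
    qed simp
  qed (use i m o P in \<open>auto simp: writes_prob_prog writes_mix_prog writes_copy_prog\<close>)
  then show ?thesis
    by (rule runs_mono) auto
qed

lemma runs_dist_prog:
  assumes s0: "ready I s0" and i: "i < num_items I" "nat_mem s0 ''i'' 0 = i"
    and v: "real_mem s0 ''c'' (nat_mem s0 ''q'' 0) = v"
    and m: "\<And>j. j < num_items I \<Longrightarrow> length (laws I ! j) \<le> m" "1 \<le> m"
  shows "runs dist_prog s0 (100000 * (num_items I * (m + Suc (total_size I))))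
    (\<lambda>s. \<forall>x\<le>total_size I. real_mem s ''P'' x = load_dist I i v (num_items I) x)"
  unfolding dist_prog_def
proof (rule runs_Seq_frame[OF runs_init_prog[OF s0, of i v]])
  fix s assume s: "agree_off (writes init_prog) s0 s"
    "nat_mem s ''o'' 0 = offset I 0 \<and>
      (\<forall>x\<le>total_size I. real_mem s ''P'' x = load_dist I i v 0 x)"
  have "ready I s"
    by (rule ready_agree[OF s0 s(1)]) (simp add: input_names_def writes_init_prog)
  then show "runs dist_loop s (33 * (num_items I * (3000 * (m + Suc (total_size I)))))
      (\<lambda>s. \<forall>x\<le>total_size I. real_mem s ''P'' x = load_dist I i v (num_items I) x)"
    using i v m s by (intro runs_dist_loop) (auto simp: agree_off_nat agree_off_real writes_init_prog)
next
  have "1 * Suc (total_size I) \<le> num_items I * (m + Suc (total_size I))"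
    using i by (intro mult_mono) auto
  then show "1000 * Suc (total_size I) + 33 * (num_items I * (3000 * (m + Suc (total_size I)))) \<le>
      100000 * (num_items I * (m + Suc (total_size I)))"
    by linarith
qed

section \<open>Accumulating the kinks over all items and values\<close>

definition weight_prog :: com where
  "weight_prog = Cond (RLess (ROfNat (NConst 0)) (RRead ''c'' (NVar ''q'')))
     (RWrite ''w'' (NConst 0) (RDiv (RMul (RRead ''p'' (NVar ''q'')) (RRead ''d'' (NVar ''i'')))
       (ROfNat (NRead ''a'' (NVar ''i'')))))
     (RWrite ''w'' (NConst 0) (ROfNat (NConst 0)))"

definition add_prog :: com where
  "add_prog = For ''s'' (NAdd (NVar ''A'') (NConst 1))
     (Cond (NLess (NVar ''s'') (NRead ''a'' (NVar ''i'')))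
       (RWrite ''D'' (NVar ''s'') (RAdd (RRead ''D'' (NVar ''s''))
         (RMul (RVar ''w'') (RRead ''P'' (NVar ''s'')))))
       (RWrite ''D'' (NVar ''s'') (RAdd (RRead ''D'' (NVar ''s''))
         (RMul (RVar ''w'') (RSub (RRead ''P'' (NVar ''s''))
           (RRead ''P'' (NSub (NVar ''s'') (NRead ''a'' (NVar ''i'')))))))))"

lemma writes_weight_prog: "writes weight_prog = {''w''}"
  by (auto simp: weight_prog_def)

lemma writes_add_prog: "writes add_prog = {''s'', ''D''}"
  by (auto simp: add_prog_def)

lemma runs_weight_prog:
  assumes s0: "ready I s0" and i: "i < num_items I" "nat_mem s0 ''i'' 0 = i"
    and k: "k < length (laws I ! i)" "nat_mem s0 ''q'' 0 = offset I i + k"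
  shows "runs weight_prog s0 40 (\<lambda>s. real_mem s ''w'' 0 = weight I i k)"
proof -
  have "nat_mem s0 ''a'' i = sizes I ! i" "real_mem s0 ''d'' i = real_of_int (leader_values I ! i)"
    "real_mem s0 ''c'' (offset I i + k) = fst (laws I ! i ! k)"
    "real_mem s0 ''p'' (offset I i + k) = snd (laws I ! i ! k)"
    using s0 i k by (auto simp: ready_def holds_input_def)
  then show ?thesis
    unfolding weight_prog_def using i k
    by (intro runs_Cond[where T' = 20] runs_RWrite) (auto simp: weight_def)
qed

lemma runs_add_prog:
  assumes s0: "ready I s0" and i: "i < num_items I" "nat_mem s0 ''i'' 0 = i"
    and w: "real_mem s0 ''w'' 0 = weight I i k"
    and P: "\<forall>x\<le>total_size I.
      real_mem s0 ''P'' x = load_dist I i (fst (laws I ! i ! k)) (num_items I) x"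
    and D: "\<forall>x\<le>total_size I. real_mem s0 ''D'' x = f x"
  shows "runs add_prog s0 (1650 * Suc (total_size I))
    (\<lambda>s. \<forall>x\<le>total_size I. real_mem s ''D'' x = f x + kink_term I i k x)"
proof -
  let ?A = "total_size I"
  \<comment> \<open>Cells from \<open>y\<close> on must be known to hold their old contents, because
    \<open>D\<close> is updated in place.\<close>
  let ?Inv = "\<lambda>y s. \<forall>x\<le>?A. real_mem s ''D'' x = f x + (if x < y then kink_term I i k x else 0)"
  have "runs add_prog s0 (33 * (Suc ?A * 50)) (?Inv (Suc ?A))"
    unfolding add_prog_def
  proof (rule runs_For[where N = "Suc ?A" and Inv = ?Inv], goal_cases)
    case (2 s)
    then show ?case using s0 by (simp add: agree_off_nat ready_def)
  next
    case (4 y s)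
    then have r: "ready I s"
      by (intro ready_agree[OF s0 4(2)]) (simp add: input_names_def)
    have eqs: "nat_mem s ''i'' 0 = i" "real_mem s ''w'' 0 = weight I i k"
      "\<And>x. x \<le> ?A \<Longrightarrow> real_mem s ''P'' x = load_dist I i (fst (laws I ! i ! k)) (num_items I) x"
      using 4(2) i w P by (auto simp: agree_off_nat agree_off_real)
    have dat: "nat_mem s ''a'' i = sizes I ! i"
      using r i by (auto simp: ready_def holds_input_def)
    show ?case
      using 4 eqs dat
      by (intro runs_Cond[where T' = 38] runs_RWrite)
        (auto simp: less_Suc_eq shifted_def kink_term_def Let_def)
  qed (use D in auto)
  then show ?thesis
    by (rule runs_mono) auto
qed

definition value_prog :: com where
  "value_prog = Seq dist_prog (Seq weight_prog (Seq add_prog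
     (NWrite ''q'' (NConst 0) (NAdd (NVar ''q'') (NConst 1)))))"

lemma writes_value_prog:
  "writes value_prog = {''o'', ''s'', ''P'', ''j'', ''Q'', ''l'', ''R'', ''w'', ''D'', ''q''}"
  by (auto simp: value_prog_def writes_dist_prog writes_weight_prog writes_add_prog)

text \<open>The function \<open>f\<close> stands for whatever \<open>D\<close> has accumulated so
  far; this generality lets the loops over values and items iterate the statement.\<close>

lemma runs_value_prog:
  assumes s0: "ready I s0" and i: "i < num_items I" "nat_mem s0 ''i'' 0 = i"
    and k: "k < length (laws I ! i)" "nat_mem s0 ''q'' 0 = offset I i + k"
    and D: "\<forall>x\<le>total_size I. real_mem s0 ''D'' x = f x"
    and m: "\<And>j. j < num_items I \<Longrightarrow> length (laws I ! j) \<le> m" "1 \<le> m"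
  shows "runs value_prog s0 (200000 * (num_items I * (m + Suc (total_size I))))
    (\<lambda>s. nat_mem s ''q'' 0 = offset I i + Suc k \<and>
      (\<forall>x\<le>total_size I. real_mem s ''D'' x = f x + kink_term I i k x))"
    (is "runs _ _ _ ?post")
  unfolding value_prog_def
proof (rule runs_Seq_frame)
  let ?A = "total_size I"
  have "real_mem s0 ''c'' (offset I i + k) = fst (laws I ! i ! k)"
    using s0 i k by (auto simp: ready_def holds_input_def)
  then show "runs dist_prog s0 (100000 * (num_items I * (m + Suc ?A)))
      (\<lambda>s. \<forall>x\<le>?A. real_mem s ''P'' x = load_dist I i (fst (laws I ! i ! k)) (num_items I) x)"
    using s0 i k m by (intro runs_dist_prog) auto
next
  let ?A = "total_size I"
  fix s1 assume s1: "agree_off (writes dist_prog) s0 s1"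
    and P: "\<forall>x\<le>?A. real_mem s1 ''P'' x = load_dist I i (fst (laws I ! i ! k)) (num_items I) x"
  have r1: "ready I s1"
    by (rule ready_agree[OF s0 s1]) (simp add: input_names_def writes_dist_prog)
  have e1: "nat_mem s1 ''i'' 0 = i" "nat_mem s1 ''q'' 0 = offset I i + k"
    "\<forall>x\<le>?A. real_mem s1 ''D'' x = f x"
    using s1 i k D by (auto simp: agree_off_nat agree_off_real writes_dist_prog)
  show "runs (Seq weight_prog (Seq add_prog
      (NWrite ''q'' (NConst 0) (NAdd (NVar ''q'') (NConst 1))))) s1 (40 + (1650 * Suc ?A + 10)) ?post"
  proof (rule runs_Seq_frame[OF runs_weight_prog[OF r1 i(1) e1(1) k(1) e1(2)]])
    fix s2 assume s2: "agree_off (writes weight_prog) s1 s2"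
      and w: "real_mem s2 ''w'' 0 = weight I i k"
    have r2: "ready I s2"
      by (rule ready_agree[OF r1 s2]) (simp add: input_names_def writes_weight_prog)
    have e2: "nat_mem s2 ''i'' 0 = i" "nat_mem s2 ''q'' 0 = offset I i + k"
      "\<forall>x\<le>?A. real_mem s2 ''D'' x = f x"
      "\<forall>x\<le>?A. real_mem s2 ''P'' x = load_dist I i (fst (laws I ! i ! k)) (num_items I) x"
      using s2 e1 P by (auto simp: agree_off_nat agree_off_real writes_weight_prog)
    show "runs (Seq add_prog (NWrite ''q'' (NConst 0) (NAdd (NVar ''q'') (NConst 1))))
        s2 (1650 * Suc ?A + 10) ?post"
    proof (rule runs_Seq_frame[OF runs_add_prog[OF r2 i(1) e2(1) w e2(4) e2(3)]])
      fix s3 assume s3: "agree_off (writes add_prog) s2 s3"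
        "\<forall>x\<le>?A. real_mem s3 ''D'' x = f x + kink_term I i k x"
      then have "nat_mem s3 ''q'' 0 = offset I i + k"
        using e2 by (simp add: agree_off_nat writes_add_prog)
      then show "runs (NWrite ''q'' (NConst 0) (NAdd (NVar ''q'') (NConst 1))) s3 10 ?post"
        using s3(2) by (intro runs_NWrite) auto
    qed simp
  qed simp
next
  let ?A = "total_size I"
  have le: "Suc ?A \<le> X \<Longrightarrow> 100000 * X + (40 + (1650 * Suc ?A + 10)) \<le> 200000 * X" for X
    by simp
  have "1 * Suc ?A \<le> num_items I * (m + Suc ?A)"
    using i by (intro mult_mono) auto
  then show "100000 * (num_items I * (m + Suc ?A)) + (40 + (1650 * Suc ?A + 10)) \<le>
      200000 * (num_items I * (m + Suc ?A))"
    by (intro le) simp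
qed

definition item_prog :: com where
  "item_prog = For ''k'' (NRead ''m'' (NVar ''i'')) value_prog"

lemma writes_item_prog:
  "writes item_prog = {''k'', ''o'', ''s'', ''P'', ''j'', ''Q'', ''l'', ''R'', ''w'', ''D'', ''q''}"
  by (simp add: item_prog_def writes_value_prog)

lemma runs_item_prog:
  assumes s0: "ready I s0" and i: "i < num_items I" "nat_mem s0 ''i'' 0 = i"
    and q: "nat_mem s0 ''q'' 0 = offset I i"
    and D: "\<forall>x\<le>total_size I. real_mem s0 ''D'' x = f x"
    and m: "\<And>j. j < num_items I \<Longrightarrow> length (laws I ! j) \<le> m" "1 \<le> m"
  shows "runs item_prog s0 (33 * (m * (200000 * (num_items I * (m + Suc (total_size I))))))
    (\<lambda>s. nat_mem s ''q'' 0 = offset I (Suc i) \<and> (\<forall>x\<le>total_size I.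
      real_mem s ''D'' x = f x + (\<Sum>k<length (laws I ! i). kink_term I i k x)))"
proof -
  let ?A = "total_size I"
  let ?Inv = "\<lambda>k s. nat_mem s ''q'' 0 = offset I i + k \<and>
    (\<forall>x\<le>?A. real_mem s ''D'' x = f x + (\<Sum>k<k. kink_term I i k x))"
  have "runs item_prog s0 (33 * (m * (200000 * (num_items I * (m + Suc ?A)))))
      (?Inv (length (laws I ! i)))"
    unfolding item_prog_def
  proof (rule runs_For[where N = "length (laws I ! i)" and Inv = ?Inv], goal_cases)
    case (2 s)
    then have "nat_mem s ''i'' 0 = i" "nat_mem s ''m'' i = length (laws I ! i)"
      using i s0 by (auto simp: agree_off_nat ready_def holds_input_def writes_value_prog)
    then show ?case by simp
  next
    case (4 k s)
    have r: "ready I s"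
      by (rule ready_agree[OF s0 4(2)]) (simp add: input_names_def writes_value_prog)
    have "nat_mem s ''i'' 0 = i"
      using 4(2) i by (simp add: agree_off_nat writes_value_prog)
    then have "runs value_prog s (200000 * (num_items I * (m + Suc ?A)))
        (\<lambda>s. nat_mem s ''q'' 0 = offset I i + Suc k \<and>
          (\<forall>x\<le>?A. real_mem s ''D'' x = (f x + (\<Sum>k<k. kink_term I i k x)) + kink_term I i k x))"
      using 4 r i m by (intro runs_value_prog) auto
    then show ?case
      by (rule runs_mono) auto
  qed (use i m q D in \<open>auto simp: writes_value_prog\<close>)
  then show ?thesis
    by (rule runs_mono) (auto simp: offset_def)
qed

definition kink_prog :: com where
  "kink_prog = For ''i'' (NVar ''n'') item_prog"

lemma writes_kink_prog:
  "writes kink_prog =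
    {''i'', ''k'', ''o'', ''s'', ''P'', ''j'', ''Q'', ''l'', ''R'', ''w'', ''D'', ''q''}"
  by (simp add: kink_prog_def writes_item_prog)

text \<open>The dominant cost arises here: at most \<open>n * m\<close> pairs of item and value,
  each paying \<open>O(n * (m + A))\<close> for its load distribution.\<close>

lemma runs_kink_prog:
  assumes s0: "ready I s0" and n: "1 \<le> num_items I"
    and q: "nat_mem s0 ''q'' 0 = 0" and D: "\<forall>x. real_mem s0 ''D'' x = 0"
    and m: "\<And>j. j < num_items I \<Longrightarrow> length (laws I ! j) \<le> m" "1 \<le> m"
  shows "runs kink_prog s0
    (33 * (num_items I * (33 * (m * (200000 * (num_items I * (m + Suc (total_size I))))))))
    (\<lambda>s. \<forall>x\<le>total_size I. real_mem s ''D'' x = kink I x)"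
proof -
  let ?A = "total_size I"
  let ?Inv = "\<lambda>i s. nat_mem s ''q'' 0 = offset I i \<and>
    (\<forall>x\<le>?A. real_mem s ''D'' x = (\<Sum>i<i. \<Sum>k<length (laws I ! i). kink_term I i k x))"
  have "runs kink_prog s0
      (33 * (num_items I * (33 * (m * (200000 * (num_items I * (m + Suc ?A)))))))
      (?Inv (num_items I))"
    unfolding kink_prog_def
  proof (rule runs_For[where N = "num_items I" and Inv = ?Inv], goal_cases)
    case (2 s)
    then show ?case
      using s0 by (simp add: agree_off_nat ready_def holds_input_def writes_item_prog)
  next
    case (4 i s)
    have r: "ready I s"
      by (rule ready_agree[OF s0 4(2)]) (simp add: input_names_def writes_item_prog)
    then have "runs item_prog s (33 * (m * (200000 * (num_items I * (m + Suc ?A)))))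
        (\<lambda>s. nat_mem s ''q'' 0 = offset I (Suc i) \<and> (\<forall>x\<le>?A. real_mem s ''D'' x =
          (\<Sum>i<i. \<Sum>k<length (laws I ! i). kink_term I i k x) +
          (\<Sum>k<length (laws I ! i). kink_term I i k x)))"
      using 4 m by (intro runs_item_prog) auto
    then show ?case
      by (rule runs_mono) auto
  qed (use n m q D in \<open>auto simp: writes_item_prog offset_def\<close>)
  then show ?thesis
    by (rule runs_mono) (auto simp: kink_def)
qed

section \<open>Value at the lower end and the maximizing scan\<close>

definition eval_prog :: com where
  "eval_prog = For ''s'' (NAdd (NVar ''A'') (NConst 1))
     (Cond (RLess (ROfNat (NVar ''s'')) (RVar ''b_min''))
       (RWrite ''H'' (NConst 0) (RAdd (RVar ''H'') (RMul (RRead ''D'' (NVar ''s''))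
         (RSub (RVar ''b_min'') (ROfNat (NVar ''s''))))))
       Skip)"

lemma writes_eval_prog: "writes eval_prog = {''s'', ''H''}"
  by (auto simp: eval_prog_def)

text \<open>The lower end need not be an integer, so its value is obtained by adding up all ramps;
  the program's test \<open>s < b_min\<close> realizes the maximum with 0.\<close>

lemma runs_eval_prog:
  assumes s0: "ready I s0" and H: "real_mem s0 ''H'' 0 = 0"
    and D: "\<forall>x\<le>total_size I. real_mem s0 ''D'' x = kink I x"
  shows "runs eval_prog s0 (1320 * Suc (total_size I))
    (\<lambda>s. real_mem s ''H'' 0 = ramp_sum I (b_min I))"
proof -
  let ?A = "total_size I"
  let ?Inv = "\<lambda>u (s :: ram_state). real_mem s ''H'' 0 = (\<Sum>x<u. kink I x * max 0 (b_min I - real x))"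
  have "runs eval_prog s0 (33 * (Suc ?A * 40)) (?Inv (Suc ?A))"
    unfolding eval_prog_def
  proof (rule runs_For[where N = "Suc ?A" and Inv = ?Inv], goal_cases)
    case (2 s)
    then show ?case using s0 by (simp add: agree_off_nat ready_def)
  next
    case (4 u s)
    then have r: "ready I s"
      by (intro ready_agree[OF s0 4(2)]) (simp add: input_names_def)
    have "real_mem s ''D'' u = kink I u"
      using 4(1,2) D by (simp add: agree_off_real)
    moreover have "real_mem s ''b_min'' 0 = b_min I"
      using r by (simp add: ready_def holds_input_def)
    ultimately show ?case
      using 4 by (intro runs_Cond[where T' = 25] runs_RWrite runs_Skip) auto
  qed (use H in auto)
  then show ?thesis
    by (rule runs_mono) (auto simp: ramp_sum_def lessThan_Suc_atMost)
qed

text \<open>The order matters: \<open>H\<close> is advanced with the old slope, because the kink at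
  \<open>u\<close> acts only to the right of \<open>u\<close>.\<close>

definition step_prog :: com where
  "step_prog = Seq
     (Cond (RLess (ROfNat (NVar ''u'')) (RVar ''b_min''))
       (RWrite ''y'' (NConst 0) (RVar ''b_min''))
       (Cond (RLess (RVar ''b_max'') (ROfNat (NVar ''u'')))
         (RWrite ''y'' (NConst 0) (RVar ''b_max''))
         (RWrite ''y'' (NConst 0) (ROfNat (NVar ''u'')))))
     (Seq (RWrite ''H'' (NConst 0) (RAdd (RVar ''H'')
            (RMul (RVar ''slope'') (RSub (RVar ''y'') (RVar ''x'')))))
     (Seq (RWrite ''x'' (NConst 0) (RVar ''y''))
     (Seq (RWrite ''slope'' (NConst 0) (RAdd (RVar ''slope'') (RRead ''D'' (NVar ''u''))))
       (Cond (RLess (RVar ''value'') (RSub (RVar ''H'') (RMul (RVar ''delta'') (RVar ''x''))))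
         (Seq (RWrite ''value'' (NConst 0)
                (RSub (RVar ''H'') (RMul (RVar ''delta'') (RVar ''x''))))
              (RWrite ''b'' (NConst 0) (RVar ''x'')))
         Skip))))"

lemma writes_step_prog: "writes step_prog = {''y'', ''H'', ''x'', ''slope'', ''value'', ''b''}"
  by (auto simp: step_prog_def)

lemma runs_step_prog:
  assumes mem: "nat_mem s ''u'' 0 = u" "real_mem s ''b_min'' 0 = b_min I"
    "real_mem s ''b_max'' 0 = b_max I" "real_mem s ''delta'' 0 = delta I"
    and le: "b_min I \<le> b_max I"
  shows "runs step_prog s 100 (\<lambda>s'. let y = clamp_cap I (real u);
      H = real_mem s ''H'' 0 + real_mem s ''slope'' 0 * (y - real_mem s ''x'' 0);
      v = H - delta I * y in
    real_mem s' ''x'' 0 = y \<and> real_mem s' ''H'' 0 = H \<and>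
    real_mem s' ''slope'' 0 = real_mem s ''slope'' 0 + real_mem s ''D'' u \<and>
    real_mem s' ''value'' 0 = max (real_mem s ''value'' 0) v \<and>
    real_mem s' ''b'' 0 = (if real_mem s ''value'' 0 < v then y else real_mem s ''b'' 0))"
  unfolding step_prog_def
proof (rule runs_Seq_frame[where ?T1.0 = 20 and ?T2.0 = 80 and
    R = "\<lambda>s'. real_mem s' ''y'' 0 = clamp_cap I (real u)"], goal_cases)
  case 1
  show ?case
    using mem le by (rule_tac runs_Cond[where T' = 13], rule_tac [2] runs_Cond[where T' = 5])
      (auto intro!: runs_RWrite simp: clamp_cap_def)
next
  case (2 s1)
  have "nat_mem s1 ''u'' 0 = u" "real_mem s1 ''delta'' 0 = delta I"
    "real_mem s1 ''D'' = real_mem s ''D''" "real_mem s1 ''x'' = real_mem s ''x''"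
    "real_mem s1 ''slope'' = real_mem s ''slope''" "real_mem s1 ''H'' = real_mem s ''H''"
    "real_mem s1 ''value'' = real_mem s ''value''" "real_mem s1 ''b'' = real_mem s ''b''"
    using mem 2(1) by (auto simp: agree_off_nat agree_off_real)
  then show ?case
    using 2(2)
    by (rule_tac runs_Seq[where ?T1.0 = 20 and ?T2.0 = 60], rule_tac runs_RWrite,
        rule_tac runs_Seq[where ?T1.0 = 5 and ?T2.0 = 55], rule_tac runs_RWrite,
        rule_tac runs_Seq[where ?T1.0 = 10 and ?T2.0 = 45], rule_tac runs_RWrite,
        rule_tac runs_Cond[where T' = 30],
        rule_tac runs_Seq[where ?T1.0 = 20 and ?T2.0 = 10], rule_tac runs_RWrite,
        rule_tac runs_RWrite)
      (auto simp: Let_def intro!: runs_Skip)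
qed simp

definition scan_prog :: com where
  "scan_prog = For ''u'' (NAdd (NVar ''A'') (NConst 1)) step_prog"

lemma runs_scan_prog:
  assumes I: "valid_instance I" and s0: "ready I s0"
    and D: "\<forall>x\<le>total_size I. real_mem s0 ''D'' x = kink I x"
    and H: "real_mem s0 ''H'' 0 = ramp_sum I (b_min I)" and x: "real_mem s0 ''x'' 0 = b_min I"
    and slope: "real_mem s0 ''slope'' 0 = 0" and b: "real_mem s0 ''b'' 0 = b_min I"
    and v: "real_mem s0 ''value'' 0 = ramp_sum I (b_min I) - delta I * b_min I"
  shows "runs scan_prog s0 (3300 * Suc (total_size I))
    (\<lambda>s. sp_solution I (real_mem s ''b'' 0) (real_mem s ''value'' 0))"
proof -
  have bb: "0 \<le> b_min I" "b_min I \<le> b_max I" "b_max I \<le> real (total_size I)"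
    using I by (auto simp: valid_instance_def)
  let ?A = "total_size I"
  let ?obj = "\<lambda>b. ramp_sum I b - delta I * b"
  let ?Inv = "\<lambda>u (s :: ram_state). real_mem s ''x'' 0 = clamp_cap I (real u - 1) \<and>
    real_mem s ''H'' 0 = ramp_sum I (clamp_cap I (real u - 1)) \<and>
    real_mem s ''slope'' 0 = (\<Sum>x<u. kink I x) \<and>
    real_mem s ''b'' 0 \<in> {b_min I..b_max I} \<and>
    real_mem s ''value'' 0 = ?obj (real_mem s ''b'' 0) \<and>
    (\<forall>w<u. ?obj (clamp_cap I (real w)) \<le> real_mem s ''value'' 0)"
  \<comment> \<open>For \<open>u = 0\<close> the invariant speaks of the position
    \<open>real 0 - 1\<close>, which makes it agree with the initial values computed at the lower
    end.\<close>
  have clamp0: "clamp_cap I (- 1) = b_min I"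
    using bb by (auto simp: clamp_cap_def)
  have clamp_in: "b_min I \<le> clamp_cap I y" "clamp_cap I y \<le> b_max I" for y
    using bb by (auto simp: clamp_cap_def)
  have "runs scan_prog s0 (33 * (Suc ?A * 100)) (?Inv (Suc ?A))"
    unfolding scan_prog_def
  proof (rule runs_For[where N = "Suc ?A" and Inv = ?Inv], goal_cases)
    case (2 s)
    then show ?case using s0 by (simp add: agree_off_nat ready_def writes_step_prog)
  next
    case 3
    show ?case using H x slope b v bb by (simp add: clamp0)
  next
    case (4 u s)
    have r: "ready I s"
      by (rule ready_agree[OF s0 4(2)]) (simp add: input_names_def writes_step_prog)
    then have mem: "real_mem s ''b_min'' 0 = b_min I"
      "real_mem s ''b_max'' 0 = b_max I" "real_mem s ''delta'' 0 = delta I"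
      by (auto simp: ready_def holds_input_def)
    have Du: "real_mem s ''D'' u = kink I u"
      using 4(1,2) D by (simp add: agree_off_real writes_step_prog)
    have H': "ramp_sum I (clamp_cap I (real u - 1)) +
        (\<Sum>x<u. kink I x) * (clamp_cap I (real u) - clamp_cap I (real u - 1)) =
        ramp_sum I (clamp_cap I (real u))"
      using ramp_sum_clamp_step[OF I, of u] by simp
    show ?case
      using runs_step_prog[OF 4(3) mem bb(2)]
    proof (rule runs_mono)
      fix s' :: ram_state
      assume s': "let y = clamp_cap I (real u);
          H = real_mem s ''H'' 0 + real_mem s ''slope'' 0 * (y - real_mem s ''x'' 0);
          v = H - delta I * y in
        real_mem s' ''x'' 0 = y \<and> real_mem s' ''H'' 0 = H \<and>
        real_mem s' ''slope'' 0 = real_mem s ''slope'' 0 + real_mem s ''D'' u \<and>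
        real_mem s' ''value'' 0 = max (real_mem s ''value'' 0) v \<and>
        real_mem s' ''b'' 0 = (if real_mem s ''value'' 0 < v then y else real_mem s ''b'' 0)"
      have inv: "real_mem s ''x'' 0 = clamp_cap I (real u - 1)"
        "real_mem s ''H'' 0 = ramp_sum I (clamp_cap I (real u - 1))"
        "real_mem s ''slope'' 0 = (\<Sum>x<u. kink I x)"
        "real_mem s ''b'' 0 \<in> {b_min I..b_max I}"
        "real_mem s ''value'' 0 = ?obj (real_mem s ''b'' 0)"
        "\<forall>w<u. ?obj (clamp_cap I (real w)) \<le> real_mem s ''value'' 0"
        using 4(4) by blast+
      have s'': "real_mem s' ''x'' 0 = clamp_cap I (real u)"
        "real_mem s' ''H'' 0 = ramp_sum I (clamp_cap I (real u))"
        "real_mem s' ''slope'' 0 = (\<Sum>x<Suc u. kink I x)"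
        "real_mem s' ''value'' 0 = max (real_mem s ''value'' 0) (?obj (clamp_cap I (real u)))"
        "real_mem s' ''b'' 0 = (if real_mem s ''value'' 0 < ?obj (clamp_cap I (real u))
          then clamp_cap I (real u) else real_mem s ''b'' 0)"
        using s' unfolding Let_def inv(1-3) H' Du by simp_all
      have "real_mem s' ''b'' 0 \<in> {b_min I..b_max I}"
        using s''(5) inv(4) clamp_in by simp
      moreover have "real_mem s' ''value'' 0 = ?obj (real_mem s' ''b'' 0)"
        using s''(4,5) inv(5) by simp
      moreover have "\<forall>w<Suc u. ?obj (clamp_cap I (real w)) \<le> real_mem s' ''value'' 0"
        using s''(4) inv(6) by (auto simp: less_Suc_eq le_max_iff_disj)
      ultimately show "?Inv (Suc u) (nat_write ''u'' 0 (Suc u) s')"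
        using s''(1-3) by simp
    qed simp
  qed (auto simp: writes_step_prog)
  then show ?thesis
  proof (rule runs_mono)
    fix s assume "?Inv (Suc ?A) s"
    then show "sp_solution I (real_mem s ''b'' 0) (real_mem s ''value'' 0)"
      using I by (intro sp_solution_clamp) (auto simp: less_Suc_eq_le)
  qed simp
qed

definition start_prog :: com where
  "start_prog = Seq (RWrite ''x'' (NConst 0) (RVar ''b_min''))
     (Seq (RWrite ''b'' (NConst 0) (RVar ''b_min''))
       (RWrite ''value'' (NConst 0) (RSub (RVar ''H'') (RMul (RVar ''delta'') (RVar ''b_min'')))))"

lemma writes_start_prog: "writes start_prog = {''x'', ''b'', ''value''}"
  by (auto simp: start_prog_def)

section \<open>Assembly and total running time\<close>

definition sp_prog :: com where
  "sp_prog = Seq size_prog (Seq kink_prog (Seq eval_prog (Seq start_prog scan_prog)))"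

lemma runs_optimize:
  assumes I: "valid_instance I" and s0: "ready I s0"
    and D: "\<forall>x\<le>total_size I. real_mem s0 ''D'' x = kink I x"
    and z: "real_mem s0 ''H'' 0 = 0" "real_mem s0 ''slope'' 0 = 0"
  shows "runs (Seq eval_prog (Seq start_prog scan_prog)) s0 (5000 * Suc (total_size I))
    (\<lambda>s. sp_solution I (real_mem s ''b'' 0) (real_mem s ''value'' 0))"
proof (rule runs_Seq_frame[OF runs_eval_prog[OF s0 z(1) D]])
  let ?A = "total_size I"
  fix s1 assume s1: "agree_off (writes eval_prog) s0 s1"
    and H: "real_mem s1 ''H'' 0 = ramp_sum I (b_min I)"
  have r1: "ready I s1"
    by (rule ready_agree[OF s0 s1]) (simp add: input_names_def writes_eval_prog)
  have e1: "real_mem s1 ''D'' = real_mem s0 ''D''" "real_mem s1 ''slope'' 0 = 0"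
    using s1 z by (auto simp: agree_off_real writes_eval_prog)
  show "runs (Seq start_prog scan_prog) s1 (20 + 3300 * Suc ?A)
      (\<lambda>s. sp_solution I (real_mem s ''b'' 0) (real_mem s ''value'' 0))"
  proof (rule runs_Seq_frame)
    show "runs start_prog s1 20 (\<lambda>s. real_mem s ''x'' 0 = b_min I \<and> real_mem s ''b'' 0 = b_min I \<and>
        real_mem s ''value'' 0 = ramp_sum I (b_min I) - delta I * b_min I)"
      unfolding start_prog_def using r1 H
      by (rule_tac runs_Seq[where ?T1.0 = 4 and ?T2.0 = 16], rule_tac runs_RWrite,
          rule_tac runs_Seq[where ?T1.0 = 4 and ?T2.0 = 12], rule_tac runs_RWrite,
          rule_tac runs_RWrite) (auto simp: ready_def holds_input_def)
  next
    fix s2 assume s2: "agree_off (writes start_prog) s1 s2"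
      "real_mem s2 ''x'' 0 = b_min I \<and> real_mem s2 ''b'' 0 = b_min I \<and>
        real_mem s2 ''value'' 0 = ramp_sum I (b_min I) - delta I * b_min I"
    have "ready I s2"
      by (rule ready_agree[OF r1 s2(1)]) (simp add: input_names_def writes_start_prog)
    then show "runs scan_prog s2 (3300 * Suc ?A)
        (\<lambda>s. sp_solution I (real_mem s ''b'' 0) (real_mem s ''value'' 0))"
      using I s2 e1 H D by (intro runs_scan_prog) (auto simp: agree_off_real writes_start_prog)
  qed simp
qed simp

lemma runs_sp_prog:
  assumes I: "valid_instance I"
    and m: "\<And>j. j < num_items I \<Longrightarrow> length (laws I ! j) \<le> m" "1 \<le> m"
  shows "runs sp_prog (encode I)
    (300000000 * (num_items I * (m * (num_items I * (m + Suc (total_size I))))))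
    (\<lambda>s. sp_solution I (real_mem s ''b'' 0) (real_mem s ''value'' 0))"
  unfolding sp_prog_def
proof (rule runs_Seq_frame)
  show "runs size_prog (encode I) (400 * num_items I) (ready I)"
    using I holds_input_encode[OF I] by (rule runs_size_prog) (simp add: encode_def)
next
  let ?A = "total_size I" and ?n = "num_items I"
  have n: "1 \<le> ?n"
    using I by (simp add: valid_instance_def)
  fix s1 assume s1: "agree_off (writes size_prog) (encode I) s1" and r1: "ready I s1"
  have e1: "nat_mem s1 ''q'' 0 = 0" "\<forall>x. real_mem s1 ''D'' x = 0"
    "real_mem s1 ''H'' 0 = 0" "real_mem s1 ''slope'' 0 = 0"
    using s1 by (auto simp: agree_off_nat agree_off_real writes_size_prog encode_def)
  show "runs (Seq kink_prog (Seq eval_prog (Seq start_prog scan_prog))) s1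
      (33 * (?n * (33 * (m * (200000 * (?n * (m + Suc ?A)))))) + 5000 * Suc ?A)
      (\<lambda>s. sp_solution I (real_mem s ''b'' 0) (real_mem s ''value'' 0))"
  proof (rule runs_Seq_frame[OF runs_kink_prog[OF r1 n e1(1,2) m]])
    fix s2 assume s2: "agree_off (writes kink_prog) s1 s2"
      and D: "\<forall>x\<le>?A. real_mem s2 ''D'' x = kink I x"
    have "ready I s2"
      by (rule ready_agree[OF r1 s2]) (simp add: input_names_def writes_kink_prog)
    then show "runs (Seq eval_prog (Seq start_prog scan_prog)) s2 (5000 * Suc ?A)
        (\<lambda>s. sp_solution I (real_mem s ''b'' 0) (real_mem s ''value'' 0))"
      using I D s2 e1 by (intro runs_optimize) (auto simp: agree_off_real writes_kink_prog)
  qed simp_all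
next
  let ?A = "total_size I" and ?n = "num_items I"
  let ?T = "?n * (m * (?n * (m + Suc ?A)))"
  have n: "1 \<le> ?n"
    using I by (simp add: valid_instance_def)
  \<comment> \<open>The linear terms from computing the size and from the final optimization are
    bounded by the main product \<open>?T\<close>.\<close>
  have "1 * (1 * (1 * Suc ?A)) \<le> ?T" "?n * (1 * (1 * 1)) \<le> ?T"
    using n m(2) by (intro mult_mono; simp)+
  moreover have "33 * (?n * (33 * (m * (200000 * (?n * (m + Suc ?A)))))) = 217800000 * ?T"
    by simp
  ultimately show "400 * ?n + (33 * (?n * (33 * (m * (200000 * (?n * (m + Suc ?A)))))) + 5000 * Suc ?A) \<le>
      300000000 * ?T"
    by linarith
qed

theorem theorem6:
  shows "\<exists>prog. solves_SP_in_time_O prog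
    (\<lambda>I. (max_values I)\<^sup>2 * (num_items I)\<^sup>2 + max_values I * (num_items I)\<^sup>2 * total_size I)"
proof -
  have "\<exists>t s. exec sp_prog (encode I) t s \<and>
      t \<le> 600000000 * ((max_values I)\<^sup>2 * (num_items I)\<^sup>2 + max_values I * (num_items I)\<^sup>2 * total_size I) \<and>
      sp_solution I (real_mem s ''b'' 0) (real_mem s ''value'' 0)"
    if I: "valid_instance I" for I
  proof -
    let ?A = "total_size I" and ?n = "num_items I" and ?m = "max_values I"
    have n: "1 \<le> ?n"
      using I by (simp add: valid_instance_def)
    have m: "length (laws I ! j) \<le> ?m" if "j < ?n" for j
      unfolding max_values_def using that by (intro Max_ge) auto
    have "pmf_of_list_wf (laws I ! 0)"
      using I n by (auto simp: valid_instance_def)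
    \<comment> \<open>The probabilities of a law sum to 1, so it has an entry; this makes the
      maximal number of values positive.\<close>
    then have "laws I ! 0 \<noteq> []"
      by (auto simp: pmf_of_list_wf_def)
    then have m1: "1 \<le> ?m"
      using m[of 0] n by (cases "laws I ! 0") auto
    \<comment> \<open>Positive sizes give \<open>?A \<ge> 1\<close>, so the extra cell for load 0 is
      absorbed by doubling the constant.\<close>
    have "sizes I ! 0 \<le> ?A"
      unfolding total_size_def using n by (intro member_le_sum) auto
    moreover have "0 < sizes I ! 0"
      using I n by (simp add: valid_instance_def)
    ultimately have "Suc ?A \<le> 2 * ?A"
      by simp
    then have "300000000 * (?n * (?m * (?n * (?m + Suc ?A)))) \<le>
        300000000 * (?n * (?m * (?n * (2 * ?m + 2 * ?A))))"
      by (intro mult_le_mono) auto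
    also have "\<dots> = 600000000 * (?m\<^sup>2 * ?n\<^sup>2 + ?m * ?n\<^sup>2 * ?A)"
      by (simp add: power2_eq_square algebra_simps)
    finally show ?thesis
      using runs_sp_prog[OF I m m1] unfolding runs_def by (meson le_trans)
  qed
  then show ?thesis
    unfolding solves_SP_in_time_O_def by blast
qed

end
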